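(* Let $n\in\mathbb N$ and $s>0$. Then $\mathbb G^n_s\in\mathcal B$ and $\mu(\mathbb G^n_s)=1$.
   Context: $\mathbb T^n=\mathbb R^n/(2\pi\mathbb Z^n)$; $|k|_1=\sum|k_j|$. $\mathbb B^n_s$ is the set of zero-average real analytic functions $f=\sum_{k\in\mathbb Z^n}f_ke^{ik\cdot x}$ on $\mathbb T^n$ with $\|f\|_s:=\sup_{k}|f_k|e^{|k|_1s}\le1$. $\mathbb Z^n_\star$ is the set of $k\in\mathbb Z^n\setminus\{0\}$ whose first non-null component is positive, and $\mathcal G^n=\{k\in\mathbb Z^n_\star:\gcd(k_1,\dots,k_n)=1\}$. For $k\in\mathcal G^n$, $\pi_{\mathbb Zk}f(\theta):=\sum_{j\in\mathbb Z}f_{jk}e^{ij\theta}$, $\theta\in\mathbb T$. $\mathbb G^n_s$ is the set of $f\in\mathbb B^n_s$ such that $\liminf_{|k|_1\to+\infty,\ k\in\mathcal G^n}|f_k|e^{|k|_1s}|k|_1^n>0$ and, for every $k\in\mathcal G^n$, $\pi_{\mathbb Zk}f$ is a Morse function with distinct critical values (all critical points are non-degenerate and distinct critical points have distinct values). Probability measure: let $\mathrm D=\{w\in\mathbb C:|w|\le1\}$ with normalized Lebesgue measure $|\cdot|$ ($|\mathrm D|=1$). On $\mathrm D^{\mathbb Z^n_\star}$, with the product topology, consider the product $\sigma$-algebra of Borel sets (generated by the cylinders $\bigotimes_kA_k$, $A_k\subseteq\mathrm D$ Borel, $A_k\ne\mathrm D$ for only finitely many $k$) and the product probability measure $\mu_\otimes(\bigotimes_kA_k)=\prod_k|A_k|$.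 The weighted Fourier map $\mathcal F(f)=\{f_ke^{|k|_1s}\}_{k\in\mathbb Z^n_\star}$ is a bijection of $\mathbb B^n_s$ onto $\mathrm D^{\mathbb Z^n_\star}$; $\mathcal B$ is the corresponding $\sigma$-algebra on $\mathbb B^n_s$ pulled back through $\mathcal F$, and $\mu(B):=\mu_\otimes(\mathcal F(B))$ for $B\in\mathcal B$. *)

theory Defs
  imports "HOL-Probability.Probability"
begin

text \<open>
  The index type \<open>'n\<close> is finite and linearly ordered, so it plays the role of \<open>{1,\<dots>,n}\<close> with
  \<open>n = CARD('n) \<ge> 1\<close>; the order is what gives a meaning to the ``first non-null component''.
  Functions on the torus are functions on \<open>real ^ 'n\<close> that are \<open>2\<pi>\<close>-periodic in each variable.
\<close>

definition norm1 :: "int ^ 'n::finite \<Rightarrow> real" where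
  "norm1 k = (\<Sum>i\<in>UNIV. \<bar>real_of_int (k $ i)\<bar>)"

definition dotk :: "int ^ 'n::finite \<Rightarrow> real ^ 'n::finite \<Rightarrow> real" where
  "dotk k x = (\<Sum>i\<in>UNIV. real_of_int (k $ i) * x $ i)"

definition torus_periodic :: "(real ^ 'n::finite \<Rightarrow> real) \<Rightarrow> bool" where
  "torus_periodic f \<longleftrightarrow>
     (\<forall>x (m :: int ^ 'n::finite). f (\<chi> i. x $ i + 2 * pi * real_of_int (m $ i)) = f x)"

text \<open>Locally the sum of a (multi-indexed, unconditionally convergent) power series.\<close>

definition real_analytic :: "(real ^ 'n::finite \<Rightarrow> real) \<Rightarrow> bool" where
  "real_analytic f \<longleftrightarrow>
     (\<forall>x0. \<exists>r>0. \<exists>c :: ('n \<Rightarrow> nat) \<Rightarrow> real. \<forall>x. (\<forall>i. \<bar>x $ i - x0 $ i\<bar> < r) \<longrightarrow>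
        ((\<lambda>\<alpha>. c \<alpha> * (\<Prod>i\<in>UNIV. (x $ i - x0 $ i) ^ \<alpha> i)) has_sum f x) UNIV)"

definition fourier_coeff :: "(real ^ 'n::finite \<Rightarrow> real) \<Rightarrow> int ^ 'n::finite \<Rightarrow> complex" where
  "fourier_coeff f k =
     (LINT x:cbox 0 (\<chi> i. 2 * pi)|lborel. complex_of_real (f x) * cis (- dotk k x))
       / complex_of_real ((2 * pi) ^ CARD('n))"

text \<open>Extended-real valued, so that an unbounded supremum is \<open>\<infinity>\<close>.\<close>

definition fourier_norm :: "real \<Rightarrow> (real ^ 'n::finite \<Rightarrow> real) \<Rightarrow> ereal" where
  "fourier_norm s f = (SUP k. ereal (cmod (fourier_coeff f k) * exp (norm1 k * s)))"

text \<open>The condition \<open>fourier_coeff f 0 = 0\<close> says that the average of \<open>f\<close> is zero.\<close>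

definition BB :: "real \<Rightarrow> (real ^ 'n::finite \<Rightarrow> real) set" where
  "BB s = {f. torus_periodic f \<and> real_analytic f \<and> fourier_coeff f 0 = 0 \<and>
     (\<forall>x. ((\<lambda>k. fourier_coeff f k * cis (dotk k x)) has_sum complex_of_real (f x)) UNIV) \<and>
     fourier_norm s f \<le> 1}"

definition Zstar :: "(int ^ 'n::{finite,linorder}) set" where
  "Zstar = {k. \<exists>i. 0 < k $ i \<and> (\<forall>j<i. k $ j = 0)}"

definition GG_gen :: "(int ^ 'n::{finite,linorder}) set" where
  "GG_gen = {k \<in> Zstar. Gcd (range (\<lambda>i. k $ i)) = 1}"

text \<open>
  The projection onto the Fourier modes that are multiples of \<open>k\<close>. For real-valued \<open>f\<close> the
  coefficients of opposite modes are conjugate, so the series is real and \<open>Re\<close> only changes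
  its type.
\<close>

definition proj_mult :: "int ^ 'n::finite \<Rightarrow> (real ^ 'n::finite \<Rightarrow> real) \<Rightarrow> real \<Rightarrow> real" where
  "proj_mult k f \<theta> =
     Re (\<Sum>\<^sub>\<infinity>j\<in>(UNIV :: int set). fourier_coeff f (\<chi> i. j * k $ i) * cis (real_of_int j * \<theta>))"

text \<open>
  Smooth functions on the circle, as \<open>2\<pi>\<close>-periodic functions of a real variable; two
  critical points are the same point of the circle iff they differ by a multiple of \<open>2\<pi>\<close>.
\<close>

definition circle_smooth :: "(real \<Rightarrow> real) \<Rightarrow> bool" where
  "circle_smooth F \<longleftrightarrow> (\<forall>\<theta>. F (\<theta> + 2 * pi) = F \<theta>) \<and>
     (\<forall>(m::nat) \<theta>. (deriv ^^ m) F differentiable (at \<theta>))"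

definition critical_point :: "(real \<Rightarrow> real) \<Rightarrow> real \<Rightarrow> bool" where
  "critical_point F \<theta> \<longleftrightarrow> deriv F \<theta> = 0"

definition morse :: "(real \<Rightarrow> real) \<Rightarrow> bool" where
  "morse F \<longleftrightarrow> circle_smooth F \<and> (\<forall>\<theta>. critical_point F \<theta> \<longrightarrow> deriv (deriv F) \<theta> \<noteq> 0)"

definition distinct_critical_values :: "(real \<Rightarrow> real) \<Rightarrow> bool" where
  "distinct_critical_values F \<longleftrightarrow>
     (\<forall>\<theta>1 \<theta>2. critical_point F \<theta>1 \<and> critical_point F \<theta>2 \<and>
        \<not> (\<exists>m::int. \<theta>1 - \<theta>2 = 2 * pi * real_of_int m) \<longrightarrow> F \<theta>1 \<noteq> F \<theta>2)"

text \<open>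
  The lower limit is along \<open>norm1 k \<rightarrow> \<infinity>\<close> with \<open>k\<close> in the generators. For
  \<open>CARD('n) = 1\<close> there is only one generator, so the filter is trivial and the
  lower limit is \<open>\<infinity>\<close>.
\<close>

definition GG :: "real \<Rightarrow> (real ^ 'n::{finite,linorder} \<Rightarrow> real) set" where
  "GG s = {f \<in> BB s.
     Liminf (inf (filtercomap norm1 at_top) (principal GG_gen))
       (\<lambda>k. ereal (cmod (fourier_coeff f k) * exp (norm1 k * s) * norm1 k ^ CARD('n))) > 0 \<and>
     (\<forall>k\<in>GG_gen. morse (proj_mult k f) \<and> distinct_critical_values (proj_mult k f))}"

definition unit_disc_measure :: "complex measure" where
  "unit_disc_measure = uniform_measure (restrict_space lborel (cball 0 1)) (cball 0 1)"

definition mu_prod :: "(int ^ 'n::{finite,linorder} \<Rightarrow> complex) measure" where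
  "mu_prod = (\<Pi>\<^sub>M k\<in>Zstar. unit_disc_measure)"

definition fourier_map ::
    "real \<Rightarrow> (real ^ 'n::{finite,linorder} \<Rightarrow> real) \<Rightarrow> int ^ 'n::{finite,linorder} \<Rightarrow> complex" where
  "fourier_map s f = (\<lambda>k\<in>Zstar. fourier_coeff f k * complex_of_real (exp (norm1 k * s)))"

definition BB_sets :: "real \<Rightarrow> (real ^ 'n::{finite,linorder} \<Rightarrow> real) set set" where
  "BB_sets s = {fourier_map s -` A \<inter> BB s | A. A \<in> sets mu_prod}"

definition mu :: "real \<Rightarrow> (real ^ 'n::{finite,linorder} \<Rightarrow> real) set \<Rightarrow> ennreal" where
  "mu s B = emeasure mu_prod (fourier_map s ` B)"

end

theory Submission
  imports Defs "HOL-Complex_Analysis.Cauchy_Integral_Formula"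
begin

text \<open>
  A function in \<open>BB s\<close> is determined by its weighted Fourier coefficients on \<open>Zstar\<close>: the average
  vanishes, and reality makes opposite coefficients conjugate. Conversely every family
  \<open>w \<in> space mu_prod\<close> comes from the real analytic function obtained by summing the series
  (\<open>synthesis_in_BB\<close>, \<open>fourier_map_synthesis\<close>), because the coefficients decay like
  \<open>exp (- (norm1 k * s))\<close>. Hence \<open>GG s\<close> is the preimage, and its image is the whole, of the set
  \<open>generic_set s\<close> of families with the two required properties, and the theorem says that this set
  is measurable with probability one.

  The lower limit is a Borel-Cantelli argument. With \<open>n = CARD('n)\<close>, the disc of radius \<open>1 / norm1 k ^ n\<close> has
  probability \<open>1 / norm1 k ^ (2 * n)\<close>, and these numbers are summable over the lattice of rank \<open>n\<close>,
  so almost surely \<open>cmod (w k) * norm1 k ^ n \<ge> 1\<close> for all but finitely many \<open>k\<close>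
  (\<open>AE_lower_bounded\<close>).

  For the Morse property fix a generator \<open>k\<close> and freeze every entry of \<open>w\<close> except \<open>z = w k\<close>. The
  projection of the function on the multiples of \<open>k\<close> then has the form
  \<open>G \<theta> + \<rho> * Re (z * cis \<theta>)\<close> with \<open>\<rho> > 0\<close> and a smooth \<open>G\<close> independent of \<open>z\<close>,
  and \<open>z\<close> is uniformly distributed in the disc. By Fubini it suffices that the bad \<open>z\<close> are Lebesgue
  null.

  \<^item> A degenerate critical point at \<open>\<theta>\<close> prescribes both the real and the imaginary part of
    \<open>\<rho> * z * cis \<theta>\<close> in terms of \<open>G\<close>. So the bad \<open>z\<close> lie on a differentiable curve
    (\<open>negligible_degenerate_parameters\<close>).

  \<^item> If all critical points are nondegenerate, they are local extrema. When \<open>z\<close> moves with unit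
    speed in direction \<open>u\<close>, the critical value at \<open>\<theta>\<close> moves with speed
    \<open>\<rho> * Re (u * cis \<theta>)\<close>. Two points of the circle that are different have different speeds
    for \<open>u = 1\<close> or for \<open>u = \<i>\<close>, and then their critical values can agree only at countably many
    positions on a line of direction \<open>u\<close> (\<open>countable_coincident_extremal_values\<close>). A Borel set that
    meets each line of one direction in a countable set is null
    (\<open>null_sets_if_countable_on_lines\<close>).

  The use of Fubini, and membership in the product \<open>\<sigma>\<close>-algebra itself, require the bad sets to be
  measurable. Up to countable unions they have the form \<open>\<exists>x\<in>S. H w x = 0\<close> with \<open>S\<close> closed and
  \<open>H\<close> continuous in \<open>x\<close>, where \<open>x\<close> is one point of the circle or a pair of points, and compactness
  replaces the quantifier by a countable search (\<open>sets_Collect_ex_zero\<close>).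
\<close>

section \<open>Sets that meet parallel lines in countable sets\<close>

text \<open>
  Translating by \<open>t *\<^sub>R u\<close> does not change the measure. Averaging over \<open>t\<close> in the unit interval
  and exchanging the integrals expresses the measure of \<open>S\<close> through the one-dimensional measures of
  \<open>{t. z + t *\<^sub>R u \<in> S}\<close>, which are zero.
\<close>

lemma null_sets_if_countable_on_lines:
  fixes S :: "'a::euclidean_space set"
  assumes S: "S \<in> sets borel" and count: "\<And>z. countable {t::real. z + t *\<^sub>R u \<in> S}"
  shows "S \<in> null_sets lborel"
proof -
  have [measurable]: "S \<in> sets borel" by (rule S)
  have shift: "(\<integral>\<^sup>+z. indicator S (z + t *\<^sub>R u) \<partial>lborel) = emeasure lborel S" for t
  proof -
    have "emeasure lborel S = (\<integral>\<^sup>+z. indicator S z \<partial>(distr lborel borel ((+) (t *\<^sub>R u))))"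
      using S by (simp add: lborel_distr_plus)
    also have "\<dots> = (\<integral>\<^sup>+z. indicator S (z + t *\<^sub>R u) \<partial>lborel)"
      by (subst nn_integral_distr) (auto simp: add.commute)
    finally show ?thesis by simp
  qed
  have "emeasure lborel S = (\<integral>\<^sup>+t. indicator {0..1::real} t * emeasure lborel S \<partial>lborel)"
    by (simp add: nn_integral_multc)
  also have "\<dots> = (\<integral>\<^sup>+t. \<integral>\<^sup>+z. indicator {0..1::real} t * indicator S (z + t *\<^sub>R u) \<partial>lborel \<partial>lborel)"
    by (simp add: nn_integral_cmult shift)
  also have "\<dots> = (\<integral>\<^sup>+z. \<integral>\<^sup>+t. indicator {0..1::real} t * indicator S (z + t *\<^sub>R u) \<partial>lborel \<partial>lborel)"
    by (rule lborel_pair.Fubini') measurable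
  also have "\<dots> = (\<integral>\<^sup>+z. 0 \<partial>(lborel :: 'a measure))"
  proof (rule nn_integral_cong)
    fix z :: 'a
    have "AE t in lborel. t \<notin> {t. z + t *\<^sub>R u \<in> S}"
      by (rule AE_not_in[OF countable_imp_null_set_lborel[OF count]])
    then have "AE t in lborel. indicator {0..1::real} t * indicator S (z + t *\<^sub>R u) = (0::ennreal)"
      by eventually_elim simp
    then show "(\<integral>\<^sup>+t. indicator {0..1::real} t * indicator S (z + t *\<^sub>R u) \<partial>lborel) = 0"
      by (subst nn_integral_0_iff_AE) auto
  qed
  finally show ?thesis
    using S by (simp add: null_sets_def)
qed

section \<open>One-parameter families of functions and their extremal values\<close>

definition local_extremum :: "(real \<Rightarrow> real) \<Rightarrow> real \<Rightarrow> bool" where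
  "local_extremum F \<theta> \<longleftrightarrow>
     (\<exists>d>0. (\<forall>y. \<bar>y - \<theta>\<bar> < d \<longrightarrow> F \<theta> \<le> F y) \<or> (\<forall>y. \<bar>y - \<theta>\<bar> < d \<longrightarrow> F y \<le> F \<theta>))"

lemma local_extremum_uminus: "local_extremum (\<lambda>x. - F x) \<theta> \<longleftrightarrow> local_extremum F \<theta>"
  unfolding local_extremum_def by auto

lemma local_extremum_if_second_derivative_pos:
  fixes F :: "real \<Rightarrow> real"
  assumes F: "\<And>x. (F has_real_derivative F' x) (at x)"
    and F': "(F' has_real_derivative l) (at \<theta>)" and "F' \<theta> = 0" "l > 0"
  shows "local_extremum F \<theta>"
proof -
  obtain d1 where d1: "d1 > 0" "\<And>h. 0 < h \<Longrightarrow> h < d1 \<Longrightarrow> F' \<theta> < F' (\<theta> + h)"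
    using DERIV_pos_inc_right[OF F' \<open>l > 0\<close>] by blast
  obtain d2 where d2: "d2 > 0" "\<And>h. 0 < h \<Longrightarrow> h < d2 \<Longrightarrow> F' (\<theta> - h) < F' \<theta>"
    using DERIV_pos_inc_left[OF F' \<open>l > 0\<close>] by blast
  have "F \<theta> \<le> F y" if "\<bar>y - \<theta>\<bar> < min d1 d2" for y
  proof (rule linorder_cases[of y \<theta>])
    assume "y < \<theta>"
    then obtain z where z: "y < z" "z < \<theta>" "F \<theta> - F y = (\<theta> - y) * F' z"
      using MVT2[of y \<theta> F F'] F by blast
    have "F' z < 0"
      using d2(2)[of "\<theta> - z"] z that \<open>F' \<theta> = 0\<close> by auto
    then have "(\<theta> - y) * F' z < 0"
      using \<open>y < \<theta>\<close> by (simp add: mult_pos_neg)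
    then show ?thesis using z by linarith
  next
    assume "y > \<theta>"
    then obtain z where z: "\<theta> < z" "z < y" "F y - F \<theta> = (y - \<theta>) * F' z"
      using MVT2[of \<theta> y F F'] F by blast
    have "F' z > 0"
      using d1(2)[of "z - \<theta>"] z that \<open>F' \<theta> = 0\<close> by auto
    then have "(y - \<theta>) * F' z > 0"
      using \<open>y > \<theta>\<close> by simp
    then show ?thesis using z by linarith
  qed auto
  then show ?thesis
    unfolding local_extremum_def using d1 d2 by (intro exI[of _ "min d1 d2"]) auto
qed

lemma local_extremum_if_nondegenerate:
  fixes F :: "real \<Rightarrow> real"
  assumes F: "\<And>x. (F has_real_derivative F' x) (at x)"
    and F': "(F' has_real_derivative l) (at \<theta>)" and "F' \<theta> = 0" "l \<noteq> 0"
  shows "local_extremum F \<theta>"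
proof (cases "l > 0")
  case True
  then show ?thesis
    using local_extremum_if_second_derivative_pos[OF F F' \<open>F' \<theta> = 0\<close>] by blast
next
  case False
  have "local_extremum (\<lambda>x. - F x) \<theta>"
    by (rule local_extremum_if_second_derivative_pos[where F' = "\<lambda>x. - F' x" and l = "- l"])
       (use False assms in \<open>auto intro: DERIV_minus\<close>)
  then show ?thesis by (simp only: local_extremum_uminus)
qed

text \<open>
  Near a local extremum the extremal value is a minimum or a maximum over a fixed small interval, and as
  a function of \<open>t\<close> such a value has difference quotients lying between the values of \<open>g\<close> on that
  interval, as one sees by comparing each extremal point with the function at the other parameter. If \<open>g\<close> exceeds a number \<open>q\<close> near
  \<open>\<theta>1\<close> and is below \<open>q\<close> near \<open>\<theta>2\<close>, the first extremal value gains on the second strictly,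
  so equality happens at most once. Countability comes from choosing the two intervals and \<open>q\<close> with
  rational end points.
\<close>

lemma countable_coincident_extremal_values:
  fixes F g :: "real \<Rightarrow> real"
  assumes g: "continuous_on UNIV g"
  shows "countable {t. \<exists>\<theta>1 \<theta>2. g \<theta>1 \<noteq> g \<theta>2 \<and>
           local_extremum (\<lambda>\<theta>. F \<theta> + t * g \<theta>) \<theta>1 \<and> local_extremum (\<lambda>\<theta>. F \<theta> + t * g \<theta>) \<theta>2 \<and>
           F \<theta>1 + t * g \<theta>1 = F \<theta>2 + t * g \<theta>2}" (is "countable ?T")
proof -
  \<comment> \<open>\<open>opt c p p' t \<theta>\<close>: the point \<open>\<theta>\<close> is a minimum (\<open>c\<close>) or maximum (\<open>\<not> c\<close>) of the function
      with parameter \<open>t\<close> on the interval from \<open>p\<close> to \<open>p'\<close>.\<close>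
  define opt :: "bool \<Rightarrow> rat \<Rightarrow> rat \<Rightarrow> real \<Rightarrow> real \<Rightarrow> bool" where
    "opt c p p' t \<theta> \<longleftrightarrow> of_rat p < \<theta> \<and> \<theta> < of_rat p' \<and>
       (\<forall>y. of_rat p < y \<and> y < of_rat p' \<longrightarrow>
          (if c then F \<theta> + t * g \<theta> \<le> F y + t * g y else F y + t * g y \<le> F \<theta> + t * g \<theta>))"
    for c p p' t \<theta>
  define T where "T = (\<lambda>(c1, p1, p1', c2, p2, p2', q). {t. \<exists>\<theta>1 \<theta>2.
      opt c1 p1 p1' t \<theta>1 \<and> opt c2 p2 p2' t \<theta>2 \<and>
      (\<forall>y. of_rat p1 < y \<and> y < of_rat p1' \<longrightarrow> of_rat q < g y) \<and>
      (\<forall>y. of_rat p2 < y \<and> y < of_rat p2' \<longrightarrow> g y < of_rat q) \<and>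
      F \<theta>1 + t * g \<theta>1 = F \<theta>2 + t * g \<theta>2})"
  \<comment> \<open>The change of the extremal value is bounded below and above by \<open>(t' - t) * g \<theta>\<close> with \<open>\<theta>\<close> one
      of the two extremal points; which point serves for which bound depends on \<open>c\<close>.\<close>
  have bounds: "\<exists>\<theta>\<in>{\<theta>0, \<theta>1}. F \<theta>1 + t' * g \<theta>1 \<ge> F \<theta>0 + t * g \<theta>0 + (t' - t) * g \<theta>"
      "\<exists>\<theta>\<in>{\<theta>0, \<theta>1}. F \<theta>1 + t' * g \<theta>1 \<le> F \<theta>0 + t * g \<theta>0 + (t' - t) * g \<theta>"
    if "opt c p p' t \<theta>0" "opt c p p' t' \<theta>1" for c p p' t t' \<theta>0 \<theta>1
  proof -
    have 1: "(if c then F \<theta>0 + t * g \<theta>0 \<le> F \<theta>1 + t * g \<theta>1 else F \<theta>1 + t * g \<theta>1 \<le> F \<theta>0 + t * g \<theta>0)"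
      and 2: "(if c then F \<theta>1 + t' * g \<theta>1 \<le> F \<theta>0 + t' * g \<theta>0 else F \<theta>0 + t' * g \<theta>0 \<le> F \<theta>1 + t' * g \<theta>1)"
      using that unfolding opt_def by blast+
    show "\<exists>\<theta>\<in>{\<theta>0, \<theta>1}. F \<theta>1 + t' * g \<theta>1 \<ge> F \<theta>0 + t * g \<theta>0 + (t' - t) * g \<theta>"
      using 1 2 by (cases c) (auto simp: algebra_simps)
    show "\<exists>\<theta>\<in>{\<theta>0, \<theta>1}. F \<theta>1 + t' * g \<theta>1 \<le> F \<theta>0 + t * g \<theta>0 + (t' - t) * g \<theta>"
      using 1 2 by (cases c) (auto simp: algebra_simps)
  qed
  have no_two: False if t: "t \<in> T i" and t': "t' \<in> T i" and "t < t'" for t t' i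
  proof -
    obtain c1 p1 p1' c2 p2 p2' q where i: "i = (c1, p1, p1', c2, p2, p2', q)"
      by (metis prod_cases7)
    obtain a1 a2 where a: "opt c1 p1 p1' t a1" "opt c2 p2 p2' t a2" "F a1 + t * g a1 = F a2 + t * g a2"
      and q: "\<forall>y. of_rat p1 < y \<and> y < of_rat p1' \<longrightarrow> of_rat q < g y"
        "\<forall>y. of_rat p2 < y \<and> y < of_rat p2' \<longrightarrow> g y < of_rat q"
      using t unfolding T_def i by auto
    obtain b1 b2 where b: "opt c1 p1 p1' t' b1" "opt c2 p2 p2' t' b2" "F b1 + t' * g b1 = F b2 + t' * g b2"
      using t' unfolding T_def i by auto
    obtain x where x: "x \<in> {a1, b1}" "F b1 + t' * g b1 \<ge> F a1 + t * g a1 + (t' - t) * g x"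
      using bounds(1)[OF a(1) b(1)] by blast
    obtain y where y: "y \<in> {a2, b2}" "F b2 + t' * g b2 \<le> F a2 + t * g a2 + (t' - t) * g y"
      using bounds(2)[OF a(2) b(2)] by blast
    have "g x > of_rat q" "g y < of_rat q"
      using q x(1) y(1) a b unfolding opt_def by auto
    then have "(t' - t) * g y < (t' - t) * g x"
      using \<open>t < t'\<close> by simp
    then show False
      using x(2) y(2) a(3) b(3) by linarith
  qed
  have "countable (T i)" for i
  proof (cases "T i = {}")
    case False
    then obtain t where "t \<in> T i" by blast
    then have "T i \<subseteq> {t}"
      using no_two by (metis linorder_neqE_linordered_idom singletonI subsetI)
    then show ?thesis by (rule countable_subset) simp
  qed simp
  then have "countable (\<Union>i. T i)" by simp
  moreover have "?T \<subseteq> (\<Union>i. T i)"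
  proof -
    have loc: "\<exists>c p p'. opt c p p' t \<theta> \<and> (\<forall>y. of_rat p < y \<and> y < of_rat p' \<longrightarrow> Q y)"
      if ext: "local_extremum (\<lambda>\<theta>. F \<theta> + t * g \<theta>) \<theta>" and op: "open {y. Q y}" and Q: "Q \<theta>" for t \<theta> Q
    proof -
      obtain d where d: "d > 0" "(\<forall>y. \<bar>y - \<theta>\<bar> < d \<longrightarrow> F \<theta> + t * g \<theta> \<le> F y + t * g y) \<or>
          (\<forall>y. \<bar>y - \<theta>\<bar> < d \<longrightarrow> F y + t * g y \<le> F \<theta> + t * g \<theta>)"
        using ext unfolding local_extremum_def by blast
      obtain e where e: "e > 0" "\<And>y. \<bar>y - \<theta>\<bar> < e \<Longrightarrow> Q y"
        using op Q unfolding open_dist by (auto simp: dist_real_def)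
      define m where "m = min d e"
      have "m > 0" using d e by (simp add: m_def)
      obtain p where p: "\<theta> - m < of_rat p" "of_rat p < \<theta>"
        using of_rat_dense[of "\<theta> - m" \<theta>] \<open>m > 0\<close> by auto
      obtain p' where p': "\<theta> < of_rat p'" "of_rat p' < \<theta> + m"
        using of_rat_dense[of \<theta> "\<theta> + m"] \<open>m > 0\<close> by auto
      have near: "\<bar>y - \<theta>\<bar> < d \<and> \<bar>y - \<theta>\<bar> < e" if "of_rat p < y" "y < of_rat p'" for y
        using that p p' unfolding m_def by linarith
      show ?thesis
        using d(2)
      proof
        assume "\<forall>y. \<bar>y - \<theta>\<bar> < d \<longrightarrow> F \<theta> + t * g \<theta> \<le> F y + t * g y"
        then have "opt True p p' t \<theta>" unfolding opt_def using near p p' by auto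
        then show ?thesis using near e(2) by blast
      next
        assume "\<forall>y. \<bar>y - \<theta>\<bar> < d \<longrightarrow> F y + t * g y \<le> F \<theta> + t * g \<theta>"
        then have "opt False p p' t \<theta>" unfolding opt_def using near p p' by auto
        then show ?thesis using near e(2) by blast
      qed
    qed
    have main: "t \<in> (\<Union>i. T i)" if g12: "g \<theta>2 < g \<theta>1" and ext1: "local_extremum (\<lambda>\<theta>. F \<theta> + t * g \<theta>) \<theta>1"
        and ext2: "local_extremum (\<lambda>\<theta>. F \<theta> + t * g \<theta>) \<theta>2" and eq: "F \<theta>1 + t * g \<theta>1 = F \<theta>2 + t * g \<theta>2" for t \<theta>1 \<theta>2
    proof -
      obtain q where q: "g \<theta>2 < of_rat q" "of_rat q < g \<theta>1"
        using of_rat_dense[OF g12] by auto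
      have "open {y. of_rat q < g y}" "open {y. g y < of_rat q}"
        by (intro open_Collect_less continuous_on_const g)+
      then obtain c1 p1 p1' c2 p2 p2' where
        "opt c1 p1 p1' t \<theta>1" "\<forall>y. of_rat p1 < y \<and> y < of_rat p1' \<longrightarrow> of_rat q < g y"
        "opt c2 p2 p2' t \<theta>2" "\<forall>y. of_rat p2 < y \<and> y < of_rat p2' \<longrightarrow> g y < of_rat q"
        using loc[OF ext1, of "\<lambda>y. of_rat q < g y"] loc[OF ext2, of "\<lambda>y. g y < of_rat q"] q by metis
      then have "t \<in> T (c1, p1, p1', c2, p2, p2', q)"
        unfolding T_def using eq by auto
      then show ?thesis by blast
    qed
    show ?thesis
      using main by (smt (verit) mem_Collect_eq subsetI)
  qed
  ultimately show ?thesis by (rule countable_subset[rotated])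
qed

text \<open>
  The two equations say \<open>\<rho> * z * cis \<theta> = G'' \<theta> + \<i> * G' \<theta>\<close>. Solving for \<open>z\<close> places the set on
  a differentiable curve in the plane.
\<close>

lemma negligible_degenerate_parameters:
  fixes G G' G'' :: "real \<Rightarrow> real"
  assumes "\<And>x. G' differentiable (at x)" "\<And>x. G'' differentiable (at x)" and \<rho>: "\<rho> \<noteq> 0"
  shows "negligible {z. \<exists>\<theta>. G' \<theta> - \<rho> * Im (z * cis \<theta>) = 0 \<and> G'' \<theta> - \<rho> * Re (z * cis \<theta>) = 0}"
proof -
  define c where "c = (\<lambda>\<theta>. cis (- \<theta>) * (of_real (G'' \<theta>) + \<i> * of_real (G' \<theta>)) / of_real \<rho>)"
  have d: "(\<lambda>x. complex_of_real (g x)) differentiable (at x)" if "g differentiable (at x)" for g :: "real \<Rightarrow> real" and x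
    using that unfolding differentiable_def by (blast intro: has_derivative_of_real)
  have cis: "(\<lambda>\<theta>. cis (- \<theta>)) differentiable (at x)" for x
  proof -
    have "((\<lambda>\<theta>. cis (- \<theta>)) has_derivative (\<lambda>t. (- t) *\<^sub>R (\<i> * cis (- x)))) (at x)"
      by (auto intro!: derivative_eq_intros)
    then show ?thesis by (auto simp: differentiable_def)
  qed
  have "c differentiable (at x)" for x
    unfolding c_def divide_inverse
    by (intro differentiable_mult differentiable_add differentiable_const cis d assms)
  then have "c differentiable_on UNIV"
    by (simp add: differentiable_on_def)
  then have "negligible (c ` UNIV)"
    by (intro negligible_differentiable_image_lowdim) auto
  moreover have "{z. \<exists>\<theta>. G' \<theta> - \<rho> * Im (z * cis \<theta>) = 0 \<and> G'' \<theta> - \<rho> * Re (z * cis \<theta>) = 0} \<subseteq> c ` UNIV"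
  proof safe
    fix z \<theta> assume *: "G' \<theta> - \<rho> * Im (z * cis \<theta>) = 0" "G'' \<theta> - \<rho> * Re (z * cis \<theta>) = 0"
    have "of_real (G'' \<theta>) + \<i> * of_real (G' \<theta>) = of_real \<rho> * (z * cis \<theta>)"
      using * by (intro complex_eqI) auto
    then have "c \<theta> = (cis (- \<theta>) * cis \<theta>) * z"
      unfolding c_def using \<rho> by (simp add: field_simps)
    then have "c \<theta> = z" by (simp add: cis_mult)
    then show "z \<in> range c" by blast
  qed
  ultimately show ?thesis by (rule negligible_subset)
qed

section \<open>Measurability and null sets in product spaces\<close>

text \<open>
  On a compact set a continuous function has a zero iff it takes arbitrarily small absolute values on a
  countable dense subset. A closed set is a countable union of compact ones.
\<close>

lemma sets_Collect_ex_zero: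
  fixes H :: "'w \<Rightarrow> 'a::euclidean_space \<Rightarrow> real"
  assumes S: "closed S"
    and meas: "\<And>x. (\<lambda>w. H w x) \<in> borel_measurable M"
    and cont: "\<And>w. w \<in> space M \<Longrightarrow> continuous_on UNIV (H w)"
  shows "{w \<in> space M. \<exists>x\<in>S. H w x = 0} \<in> sets M"
proof -
  have cpt: "{w \<in> space M. \<exists>x\<in>K. H w x = 0} \<in> sets M" if K: "compact K" for K
  proof -
    obtain T where T: "countable T" "T \<subseteq> K" "K \<subseteq> closure T"
      using separable[of K] by blast
    have "{w \<in> space M. \<exists>x\<in>K. H w x = 0} =
        (\<Inter>m::nat. \<Union>x\<in>T. {w \<in> space M. \<bar>H w x\<bar> < 1 / Suc m})"
    proof (intro equalityI subsetI)
      fix w assume "w \<in> {w \<in> space M. \<exists>x\<in>K. H w x = 0}"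
      then obtain x where w: "w \<in> space M" and x: "x \<in> K" "H w x = 0" by blast
      have "\<exists>y\<in>T. \<bar>H w y\<bar> < 1 / Suc m" for m
      proof -
        have "open {y. \<bar>H w y\<bar> < 1 / Suc m}"
          by (intro open_Collect_less continuous_on_rabs continuous_on_const cont[OF w])
        moreover have "x \<in> closure T" using x T by blast
        ultimately show ?thesis
          using x(2) open_Int_closure_eq_empty[of "{y. \<bar>H w y\<bar> < 1 / Suc m}" T] by force
      qed
      then show "w \<in> (\<Inter>m::nat. \<Union>x\<in>T. {w \<in> space M. \<bar>H w x\<bar> < 1 / Suc m})"
        using w by blast
    next
      fix w assume "w \<in> (\<Inter>m::nat. \<Union>x\<in>T. {w \<in> space M. \<bar>H w x\<bar> < 1 / Suc m})"
      then have small: "\<exists>x\<in>T. w \<in> space M \<and> \<bar>H w x\<bar> < 1 / Suc m" for m by blast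
      then have w: "w \<in> space M" and "K \<noteq> {}" using T by auto
      then obtain x0 where x0: "x0 \<in> K" "\<And>x. x \<in> K \<Longrightarrow> \<bar>H w x0\<bar> \<le> \<bar>H w x\<bar>"
        using continuous_attains_inf[OF K, of "\<lambda>x. \<bar>H w x\<bar>"] cont[OF w]
        by (metis continuous_on_rabs continuous_on_subset top_greatest)
      have "\<bar>H w x0\<bar> < 1 / Suc m" for m
        using small[of m] x0(2) T(2) by (meson order_le_less_trans subsetD)
      then have "\<bar>H w x0\<bar> \<le> 0"
        by (meson linorder_not_le nat_approx_posE order_less_asym)
      then show "w \<in> {w \<in> space M. \<exists>x\<in>K. H w x = 0}"
        using w x0(1) by auto
    qed
    also have "\<dots> \<in> sets M"
      using T(1) meas by (intro sets.countable_INT sets.countable_UN') auto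
    finally show ?thesis .
  qed
  have "{w \<in> space M. \<exists>x\<in>S. H w x = 0} =
      (\<Union>N::nat. {w \<in> space M. \<exists>x\<in>S \<inter> cball 0 (real N). H w x = 0})"
  proof safe
    fix w x assume "w \<in> space M" "x \<in> S" "H w x = 0"
    moreover obtain N :: nat where "norm x \<le> real N" using real_arch_simple by blast
    ultimately have "w \<in> {w \<in> space M. \<exists>x\<in>S \<inter> cball 0 (real N). H w x = 0}"
      by auto
    then show "w \<in> (\<Union>N::nat. {w \<in> space M. \<exists>x\<in>S \<inter> cball 0 (real N). H w x = 0})"
      by (rule UN_I[OF UNIV_I])
  qed auto
  also have "\<dots> \<in> sets M"
    by (intro sets.countable_UN image_subsetI cpt closed_Int_compact S compact_cball)
  finally show ?thesis .
qed

text \<open>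
  An infinite product of probability measures is the binary product of one factor with the product of
  the others, so this is the Fubini theorem for null sets.
\<close>

lemma null_sets_PiM_if_null_slices:
  assumes prob: "\<And>i. i \<in> I \<Longrightarrow> prob_space (M i)" and k: "k \<in> I" and N: "N \<in> sets (PiM I M)"
    and slice: "\<And>w. w \<in> space (PiM I M) \<Longrightarrow> {z \<in> space (M k). w(k := z) \<in> N} \<in> null_sets (M k)"
  shows "N \<in> null_sets (PiM I M)"
proof -
  define J where "J = I - {k}"
  have I: "insert k J = I" using k by (auto simp: J_def)
  interpret k: prob_space "M k" using prob k by blast
  interpret J: prob_space "PiM J M" using prob by (intro prob_space_PiM) (auto simp: J_def)
  interpret kJ: pair_sigma_finite "M k" "PiM J M" ..
  let ?g = "\<lambda>(x, X). X(k := x)"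
  have g: "?g \<in> M k \<Otimes>\<^sub>M PiM J M \<rightarrow>\<^sub>M PiM I M"
    unfolding I[symmetric] by measurable
  define A where "A = ?g -` N \<inter> space (M k \<Otimes>\<^sub>M PiM J M)"
  have A: "A \<in> sets (M k \<Otimes>\<^sub>M PiM J M)"
    unfolding A_def using g N by (rule measurable_sets)
  have "emeasure (PiM I M) N = emeasure (distr (M k \<Otimes>\<^sub>M PiM J M) (PiM I M) ?g) N"
    using distr_pair_PiM_eq_PiM[of J M k] prob k unfolding I by (simp add: J_def)
  also have "\<dots> = emeasure (M k \<Otimes>\<^sub>M PiM J M) A"
    unfolding A_def by (rule emeasure_distr[OF g N])
  also have "\<dots> = (\<integral>\<^sup>+y. emeasure (M k) ((\<lambda>x. (x, y)) -` A) \<partial>PiM J M)"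
    by (rule kJ.emeasure_pair_measure_alt2[OF A])
  also have "\<dots> = (\<integral>\<^sup>+y. 0 \<partial>PiM J M)"
  proof (rule nn_integral_cong)
    fix y assume y: "y \<in> space (PiM J M)"
    obtain x0 where x0: "x0 \<in> space (M k)" using k.not_empty by blast
    have "y(k := x0) \<in> space (PiM I M)"
      unfolding I[symmetric] using y x0 by (auto simp: space_PiM PiE_def extensional_def)
    from slice[OF this] have "{z \<in> space (M k). y(k := z) \<in> N} \<in> null_sets (M k)" by simp
    moreover have "(\<lambda>x. (x, y)) -` A = {z \<in> space (M k). y(k := z) \<in> N}"
      using y by (auto simp: A_def space_pair_measure)
    ultimately show "emeasure (M k) ((\<lambda>x. (x, y)) -` A) = 0" by auto
  qed
  finally show ?thesis using N by (simp add: null_sets_def)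
qed

section \<open>Boundary values of holomorphic functions on the unit circle\<close>

text \<open>
  The derivative with respect to \<open>\<theta>\<close> of the real part of \<open>H (cis \<theta>)\<close> is the real part of
  another holomorphic function at \<open>cis \<theta>\<close>, namely \<open>\<i> * z * deriv H z\<close>. This closure property gives
  derivatives of all orders at once and avoids differentiating Fourier series term by term.
\<close>

definition circle_trace :: "(complex \<Rightarrow> complex) \<Rightarrow> real \<Rightarrow> real" where
  "circle_trace H \<theta> = Re (H (cis \<theta>))"

definition angular_deriv :: "(complex \<Rightarrow> complex) \<Rightarrow> complex \<Rightarrow> complex" where
  "angular_deriv H z = \<i> * z * deriv H z"

lemma angular_deriv_holomorphic:
  "H holomorphic_on U \<Longrightarrow> open U \<Longrightarrow> angular_deriv H holomorphic_on U"
  unfolding angular_deriv_def by (intro holomorphic_intros) auto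

lemma circle_trace_has_derivative:
  assumes H: "H holomorphic_on U" and U: "open U" "sphere 0 1 \<subseteq> U"
  shows "(circle_trace H has_real_derivative circle_trace (angular_deriv H) \<theta>) (at \<theta>)"
proof -
  have "cis \<theta> \<in> U" using U by (auto simp: sphere_def)
  then have "(H has_field_derivative deriv H (cis \<theta>)) (at (cis \<theta>))"
    by (rule holomorphic_derivI[OF H U(1)])
  moreover have "(cis has_vector_derivative \<i> * cis \<theta>) (at \<theta>)"
    unfolding has_vector_derivative_def by (auto intro!: derivative_eq_intros)
  ultimately have "((H \<circ> cis) has_vector_derivative \<i> * cis \<theta> * deriv H (cis \<theta>)) (at \<theta>)"
    by (rule field_vector_diff_chain_at[rotated])
  then have "((\<lambda>\<theta>. Re ((H \<circ> cis) \<theta>)) has_vector_derivative Re (\<i> * cis \<theta> * deriv H (cis \<theta>))) (at \<theta>)"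
    by (rule bounded_linear.has_vector_derivative[OF bounded_linear_Re])
  then show ?thesis
    by (simp add: circle_trace_def[abs_def] angular_deriv_def[abs_def] has_real_derivative_iff_has_vector_derivative)
qed

lemma deriv_circle_trace:
  assumes "H holomorphic_on U" "open U" "sphere 0 1 \<subseteq> U"
  shows "deriv (circle_trace H) = circle_trace (angular_deriv H)"
  using circle_trace_has_derivative[OF assms] by (auto intro: DERIV_imp_deriv)

lemma circle_smooth_circle_trace:
  assumes H: "H holomorphic_on U" and U: "open U" "sphere 0 1 \<subseteq> U"
  shows "circle_smooth (circle_trace H)"
proof -
  have "\<exists>H'. H' holomorphic_on U \<and> (deriv ^^ m) (circle_trace H) = circle_trace H'" for m
  proof (induction m)
    case (Suc m)
    then obtain H' where "H' holomorphic_on U" "(deriv ^^ m) (circle_trace H) = circle_trace H'" by blast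
    then show ?case
      using angular_deriv_holomorphic deriv_circle_trace U by auto
  qed (use H in auto)
  then have "(deriv ^^ m) (circle_trace H) differentiable (at \<theta>)" for m \<theta>
    using circle_trace_has_derivative[OF _ U] unfolding real_differentiable_def by metis
  moreover have "circle_trace H (\<theta> + 2 * pi) = circle_trace H \<theta>" for \<theta>
    by (simp add: circle_trace_def cis.code)
  ultimately show ?thesis by (auto simp: circle_smooth_def)
qed

section \<open>The uniform measure on the disc and its infinite product\<close>

lemma unit_disc_area: "emeasure lborel (cball 0 1 :: complex set) = ennreal pi"
  by (simp add: emeasure_cball unit_ball_vol_2)

lemma space_unit_disc_measure [simp]: "space unit_disc_measure = cball 0 1"
  by (simp add: unit_disc_measure_def space_restrict_space)

lemma sets_unit_disc_measure: "sets unit_disc_measure = {B \<in> sets borel. B \<subseteq> cball 0 1}"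
  by (subst unit_disc_measure_def) (auto simp: sets_restrict_space_iff sets_restrict_space)

lemma emeasure_unit_disc_measure:
  assumes "B \<in> sets borel" "B \<subseteq> cball 0 1"
  shows "emeasure unit_disc_measure B = emeasure lborel B / ennreal pi"
proof -
  have c: "emeasure (restrict_space lborel (cball 0 1)) C = emeasure lborel C" if "C \<subseteq> cball 0 1" for C :: "complex set"
    using that by (intro emeasure_restrict_space) auto
  have B: "B \<in> sets (restrict_space lborel (cball 0 1))" "cball 0 1 \<inter> B = B"
    using assms by (auto simp: sets_restrict_space_iff)
  show ?thesis
    unfolding unit_disc_measure_def
    by (subst emeasure_uniform_measure) (use assms B c in \<open>auto simp: sets_restrict_space_iff unit_disc_area\<close>)
qed

lemma prob_space_unit_disc_measure: "prob_space unit_disc_measure"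
proof
  have "emeasure lborel (cball 0 1 :: complex set) / ennreal pi = 1"
    unfolding unit_disc_area by (intro ennreal_divide_self) auto
  then show "emeasure unit_disc_measure (space unit_disc_measure) = 1"
    by (simp add: emeasure_unit_disc_measure)
qed

lemma null_sets_unit_disc_measureI:
  assumes "B \<in> null_sets lborel" "B \<subseteq> cball 0 1"
  shows "B \<in> null_sets unit_disc_measure"
  using assms by (auto simp: null_sets_def sets_unit_disc_measure emeasure_unit_disc_measure)

lemma space_mu_prod: "space mu_prod = (\<Pi>\<^sub>E k\<in>Zstar. cball 0 1)"
  by (simp add: mu_prod_def space_PiM)

lemma prob_space_mu_prod: "prob_space mu_prod"
  unfolding mu_prod_def by (intro prob_space_PiM prob_space_unit_disc_measure)

lemma measurable_mu_prod_component:
  assumes "k \<in> Zstar"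
  shows "(\<lambda>w. w k) \<in> borel_measurable mu_prod"
proof -
  have "(\<lambda>w. w k) \<in> measurable mu_prod unit_disc_measure"
    unfolding mu_prod_def using assms by (rule measurable_component_singleton)
  moreover have "(\<lambda>z. z) \<in> borel_measurable unit_disc_measure"
    by (auto simp: measurable_def sets_unit_disc_measure)
  ultimately show ?thesis by (rule measurable_compose)
qed

section \<open>Lattice vectors and Fourier coefficients\<close>

lemma zero_notin_Zstar: "0 \<notin> Zstar"
  by (simp add: Zstar_def)

lemma uminus_notin_Zstar:
  assumes "k \<in> Zstar" shows "- k \<notin> Zstar"
proof
  assume "- k \<in> Zstar"
  then obtain i where i: "0 < (- k) $ i" "\<And>j. j < i \<Longrightarrow> (- k) $ j = 0" by (auto simp: Zstar_def)
  obtain i' where i': "0 < k $ i'" "\<And>j. j < i' \<Longrightarrow> k $ j = 0" using assms by (auto simp: Zstar_def)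
  show False
    using i i' by (cases i i' rule: linorder_cases) force+
qed

lemma Zstar_cases: "k = 0 \<or> k \<in> Zstar \<or> - k \<in> Zstar"
proof (cases "k = 0")
  case False
  define i where "i = Min {i. k $ i \<noteq> 0}"
  have ne: "{i. k $ i \<noteq> 0} \<noteq> {}" using False by (auto simp: vec_eq_iff)
  have "i \<in> {i. k $ i \<noteq> 0}" unfolding i_def by (rule Min_in) (use ne in auto)
  moreover have "k $ j = 0" if "j < i" for j
    using that Min_le[of "{i. k $ i \<noteq> 0}" j] unfolding i_def by (meson finite leD mem_Collect_eq)
  ultimately show ?thesis
    unfolding Zstar_def by (cases "k $ i > 0") (auto intro!: exI[of _ i])
qed simp

lemma norm1_nonneg: "norm1 k \<ge> 0"
  by (simp add: norm1_def sum_nonneg)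

lemma norm1_uminus [simp]: "norm1 (- k) = norm1 k"
  by (simp add: norm1_def)

lemma norm1_ge_1:
  assumes "k \<noteq> 0" shows "norm1 k \<ge> 1"
proof -
  obtain i where "k $ i \<noteq> 0" using assms by (auto simp: vec_eq_iff)
  then have "1 \<le> \<bar>real_of_int (k $ i)\<bar>" by linarith
  also have "\<dots> \<le> norm1 k"
    unfolding norm1_def by (rule member_le_sum) auto
  finally show ?thesis .
qed

lemma norm1_multiple: "norm1 (\<chi> i. j * k $ i) = \<bar>real_of_int j\<bar> * norm1 k"
  by (simp add: norm1_def sum_distrib_left abs_mult)

lemma multiple_in_Zstar: "k \<in> Zstar \<Longrightarrow> j > 0 \<Longrightarrow> (\<chi> i. j * k $ i) \<in> Zstar"
  unfolding Zstar_def by (auto simp: zero_less_mult_iff)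

lemma multiple_eq_self_iff:
  fixes k :: "int ^ 'n::finite"
  assumes "k \<noteq> 0" shows "(\<chi> i. j * k $ i) = k \<longleftrightarrow> j = 1"
proof -
  obtain i where "k $ i \<noteq> 0" using assms by (auto simp: vec_eq_iff)
  then have "j = 1" if "(\<chi> i. j * k $ i) = k"
    using arg_cong[OF that, of "\<lambda>v. v $ i"] by simp
  then show ?thesis by (auto simp: vec_eq_iff)
qed

lemma dotk_uminus: "dotk (- k) x = - dotk k x"
  by (simp add: dotk_def sum_negf)

lemma fourier_coeff_uminus: "fourier_coeff f (- k) = cnj (fourier_coeff f k)"
proof -
  have "(LINT x:cbox 0 (\<chi> i. 2 * pi)|lborel. complex_of_real (f x) * cis (- dotk (- k) x)) =
      (LINT x:cbox 0 (\<chi> i. 2 * pi)|lborel. cnj (complex_of_real (f x) * cis (- dotk k x)))"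
    by (simp add: dotk_uminus cis_cnj)
  also have "\<dots> = cnj (LINT x:cbox 0 (\<chi> i. 2 * pi)|lborel. complex_of_real (f x) * cis (- dotk k x))"
    unfolding set_lebesgue_integral_def Bochner_Integration.integral_cnj[symmetric]
    by (rule Bochner_Integration.integral_cong) (simp_all add: scaleR_conv_of_real)
  finally show ?thesis
    by (simp add: fourier_coeff_def)
qed

text \<open>
  The Fourier coefficients that a function in \<open>BB s\<close> must have when its weighted coefficients on
  \<open>Zstar\<close> are \<open>w\<close>.
\<close>

definition mode_coeff ::
    "real \<Rightarrow> (int ^ 'n::{finite,linorder} \<Rightarrow> complex) \<Rightarrow> int ^ 'n::{finite,linorder} \<Rightarrow> complex" where
  "mode_coeff s w k = (if k \<in> Zstar then w k else if - k \<in> Zstar then cnj (w (- k)) else 0)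
     * complex_of_real (exp (- norm1 k * s))"

lemma fourier_coeff_bound:
  assumes "f \<in> BB s"
  shows "cmod (fourier_coeff f k) * exp (norm1 k * s) \<le> 1"
proof -
  have "ereal (cmod (fourier_coeff f k) * exp (norm1 k * s)) \<le> fourier_norm s f"
    unfolding fourier_norm_def by (rule SUP_upper) simp
  also have "\<dots> \<le> 1" using assms by (simp add: BB_def)
  finally show ?thesis by simp
qed

lemma fourier_map_in_space:
  assumes "f \<in> BB s"
  shows "fourier_map s f \<in> space mu_prod"
  using fourier_coeff_bound[OF assms] by (auto simp: space_mu_prod fourier_map_def norm_mult)

lemma fourier_coeff_eq_mode_coeff:
  fixes f :: "real ^ 'n::{finite,linorder} \<Rightarrow> real"
  assumes "f \<in> BB s"
  shows "fourier_coeff f = mode_coeff s (fourier_map s f)"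
proof
  fix k :: "int ^ 'n::{finite,linorder}"
  have e: "complex_of_real (exp (norm1 k * s)) * complex_of_real (exp (- norm1 k * s)) = 1"
    by (simp flip: of_real_mult exp_add)
  consider "k = 0" | "k \<in> Zstar" | "- k \<in> Zstar" "k \<notin> Zstar"
    using Zstar_cases[of k] by blast
  then show "fourier_coeff f k = mode_coeff s (fourier_map s f) k"
  proof cases
    case 1
    then show ?thesis
      using assms by (simp add: BB_def mode_coeff_def zero_notin_Zstar)
  next
    case 2
    then show ?thesis using e by (simp add: mode_coeff_def fourier_map_def mult.assoc)
  next
    case 3
    have "mode_coeff s (fourier_map s f) k = cnj (fourier_coeff f (- k))"
      using 3 e by (simp add: mode_coeff_def fourier_map_def mult.assoc)
    then show ?thesis by (simp add: fourier_coeff_uminus)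
  qed
qed

lemma mode_coeff_zero: "mode_coeff s w 0 = 0"
  by (simp add: mode_coeff_def zero_notin_Zstar)

lemma mode_coeff_uminus: "mode_coeff s w (- k) = cnj (mode_coeff s w k)"
  using uminus_notin_Zstar[of k] by (auto simp: mode_coeff_def)

lemma mode_coeff_bound:
  assumes "w \<in> space mu_prod"
  shows "cmod (mode_coeff s w k) \<le> exp (- norm1 k * s)"
  using assms unfolding mode_coeff_def space_mu_prod
  by (auto simp: norm_mult PiE_iff)

text \<open>
  The mode \<open>0\<close> vanishes and opposite modes are conjugate, so the projection on the
  multiples of \<open>k\<close> is the real part of a power series with only positive powers; this is the origin of
  the factor \<open>2\<close> and of the vanishing constant term.
\<close>

definition ray_coeff ::
    "real \<Rightarrow> (int ^ 'n::{finite,linorder} \<Rightarrow> complex) \<Rightarrow> int ^ 'n::{finite,linorder} \<Rightarrow> nat \<Rightarrow> complex" where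
  "ray_coeff s w k j = (if j = 0 then 0 else
     2 * w (\<chi> i. int j * k $ i) * complex_of_real (exp (- (real j * norm1 k * s))))"

definition ray_series ::
    "real \<Rightarrow> (int ^ 'n::{finite,linorder} \<Rightarrow> complex) \<Rightarrow> int ^ 'n::{finite,linorder} \<Rightarrow> complex \<Rightarrow> complex" where
  "ray_series s w k z = (\<Sum>j. ray_coeff s w k j * z ^ j)"

context
  fixes s :: real and w :: "int ^ 'n::{finite,linorder} \<Rightarrow> complex" and k :: "int ^ 'n::{finite,linorder}"
  assumes s: "s > 0" and w: "w \<in> space mu_prod" and k: "k \<in> Zstar"
begin

lemma ray_coeff_bound: "cmod (ray_coeff s w k j) \<le> 2 * exp (- (norm1 k * s)) ^ j"
proof (cases "j = 0")
  case False
  then have "(\<chi> i. int j * k $ i) \<in> Zstar" using k by (intro multiple_in_Zstar) auto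
  then have "cmod (w (\<chi> i. int j * k $ i)) \<le> 1" using w by (auto simp: space_mu_prod PiE_iff)
  then show ?thesis
    by (simp add: ray_coeff_def norm_mult exp_of_nat_mult[symmetric] mult_ac)
qed (simp add: ray_coeff_def)

lemma abs_summable_ray:
  assumes "cmod z < exp (norm1 k * s)"
  shows "summable (\<lambda>j. norm (ray_coeff s w k j * z ^ j))"
proof (rule summable_comparison_test')
  have "norm (exp (- (norm1 k * s)) * cmod z) < 1"
    using assms by (simp add: exp_minus field_simps abs_mult)
  then show "summable (\<lambda>j. 2 * (exp (- (norm1 k * s)) * cmod z) ^ j)"
    by (intro summable_mult summable_geometric) simp
  show "norm (norm (ray_coeff s w k j * z ^ j)) \<le> 2 * (exp (- (norm1 k * s)) * cmod z) ^ j" for j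
    using mult_right_mono[OF ray_coeff_bound, of "cmod z ^ j" j]
    by (simp add: norm_mult norm_power power_mult_distrib mult.assoc)
qed

lemma ray_series_sums:
  "cmod z < exp (norm1 k * s) \<Longrightarrow> (\<lambda>j. ray_coeff s w k j * z ^ j) sums ray_series s w k z"
  unfolding ray_series_def by (rule summable_sums[OF summable_norm_cancel[OF abs_summable_ray]])

lemma norm1_mult_pos: "norm1 k * s > 0"
proof (rule mult_pos_pos)
  have "k \<noteq> 0" using k by (auto simp: zero_notin_Zstar)
  then show "norm1 k > 0" using norm1_ge_1[of k] by simp
qed (rule s)

text \<open>
  Half of the exponent leaves room on both sides: the ball lies strictly inside the disc of convergence,
  and its radius is still larger than \<open>1\<close>.
\<close>

lemma ray_series_holomorphic: "ray_series s w k holomorphic_on ball 0 (exp (norm1 k * s / 2))"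
proof -
  let ?R = "exp (norm1 k * s / 2)"
  have R: "?R < exp (norm1 k * s)" using norm1_mult_pos unfolding exp_less_cancel_iff by linarith
  then have "summable (\<lambda>j. ray_coeff s w k j * complex_of_real ?R ^ j)"
    by (intro summable_norm_cancel[OF abs_summable_ray]) simp
  then have "summable (\<lambda>j. ray_coeff s w k j * complex_of_real (?R ^ j))"
    by (simp only: of_real_power)
  from power_series_and_derivative_0[OF this] obtain g g' where "\<forall>z. cmod z < ?R \<longrightarrow>
      (\<lambda>j. ray_coeff s w k j * z ^ j) sums g z \<and>
      (\<lambda>j. of_nat j * ray_coeff s w k j * z ^ (j - 1)) sums g' z \<and> (g has_field_derivative g' z) (at z)"
    by blast
  then have g: "(\<lambda>j. ray_coeff s w k j * z ^ j) sums g z" "(g has_field_derivative g' z) (at z)"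
    if "cmod z < ?R" for z using that by blast+
  then have "g holomorphic_on ball 0 ?R"
    unfolding holomorphic_on_def field_differentiable_def
    by (metis has_field_derivative_at_within mem_ball_0)
  moreover have "g z = ray_series s w k z" if "z \<in> ball 0 ?R" for z
    using g(1)[of z] ray_series_sums[of z] R that sums_unique2 by (metis less_trans mem_ball_0)
  ultimately show ?thesis
    using holomorphic_transform by blast
qed

lemma sphere_subset_ball_ray: "sphere (0::complex) 1 \<subseteq> ball 0 (exp (norm1 k * s / 2))"
proof
  fix z :: complex assume "z \<in> sphere 0 1"
  moreover have "1 < exp (norm1 k * s / 2)"
    unfolding one_less_exp_iff using norm1_mult_pos by (rule half_gt_zero)
  ultimately show "z \<in> ball 0 (exp (norm1 k * s / 2))" by simp
qed

lemma infsum_mode_coeff_multiples: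
  "Re (\<Sum>\<^sub>\<infinity>j\<in>(UNIV :: int set). mode_coeff s w (\<chi> i. j * k $ i) * cis (real_of_int j * \<theta>)) =
     circle_trace (ray_series s w k) \<theta>"
proof -
  let ?g = "\<lambda>j::int. mode_coeff s w (\<chi> i. j * k $ i) * cis (real_of_int j * \<theta>)"
  let ?h = "\<lambda>j::nat. ray_coeff s w k j * cis \<theta> ^ j / 2"
  let ?S = "ray_series s w k (cis \<theta>) / 2"
  have zero: "?g 0 = 0"
    using mode_coeff_zero[of s w] by (simp add: zero_vec_def)
  have gh: "?g (int j) = ?h j" for j
  proof (cases "j = 0")
    case False
    then have "(\<chi> i. int j * k $ i) \<in> Zstar" using k by (intro multiple_in_Zstar) auto
    then show ?thesis
      using False by (simp add: mode_coeff_def ray_coeff_def norm1_multiple Complex.DeMoivre mult_ac)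
  next
    case True
    then show ?thesis using zero by (simp add: ray_coeff_def)
  qed
  have neg: "?g (- int j) = cnj (?g (int j))" for j
    using mode_coeff_uminus[of s w "\<chi> i. int j * k $ i"]
    by (simp add: cis_cnj uminus_vec_def)
  have z: "cmod (cis \<theta>) < exp (norm1 k * s)" using norm1_mult_pos unfolding norm_cis one_less_exp_iff .
  have sums: "?h sums ?S" using sums_divide[OF ray_series_sums[OF z], of 2] .
  have summ: "summable (\<lambda>j. norm (?h j))"
    using summable_divide[OF abs_summable_ray[OF z], of 2] by (simp add: norm_divide)
  have pos: "(?g has_sum ?S) (range int)"
    unfolding has_sum_reindex[OF inj_of_nat] o_def gh by (rule norm_summable_imp_has_sum[OF summ sums])
  have "?h 0 = 0" by (simp add: ray_coeff_def)
  then have "(\<lambda>j. ?h (Suc j)) sums ?S"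
    using sums sums_Suc_iff[of ?h] by simp
  moreover have "summable (\<lambda>j. norm (?h (Suc j)))"
    using summ summable_Suc_iff[of "\<lambda>j. norm (?h j)"] by blast
  ultimately have "((\<lambda>j. ?h (Suc j)) has_sum ?S) UNIV"
    by (intro norm_summable_imp_has_sum)
  then have "((\<lambda>j. cnj (?h (Suc j))) has_sum cnj ?S) UNIV"
    by (simp only: has_sum_cnj_iff)
  moreover have "inj (\<lambda>j. - int (Suc j))" by (auto simp: inj_on_def)
  ultimately have "(?g has_sum cnj ?S) (range (\<lambda>j. - int (Suc j)))"
    by (simp only: has_sum_reindex o_def gh neg)
  then have "(?g has_sum (?S + cnj ?S)) (range int \<union> range (\<lambda>j. - int (Suc j)))"
    by (intro has_sum_Un_disjoint pos) auto
  moreover have "range int \<union> range (\<lambda>j. - int (Suc j)) = UNIV"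
  proof (intro equalityI subsetI UNIV_I)
    show "j \<in> range int \<union> range (\<lambda>j. - int (Suc j))" for j
      by (cases j rule: int_cases) auto
  qed
  ultimately have "infsum ?g UNIV = ?S + cnj ?S"
    by (simp add: infsumI)
  then show ?thesis by (simp add: circle_trace_def)
qed

end

text \<open>
  Among the multiples of \<open>k\<close> with positive factor only \<open>k\<close> itself involves the entry \<open>w k\<close>, and the
  power series depends on it affinely.
\<close>

lemma ray_series_upd:
  assumes s: "s > 0" and w: "w \<in> space mu_prod" and k: "k \<in> Zstar"
    and z: "cmod z \<le> 1" and \<zeta>: "cmod \<zeta> < exp (norm1 k * s)"
  shows "ray_series s (w(k := z)) k \<zeta> =
     ray_series s (w(k := 0)) k \<zeta> + 2 * complex_of_real (exp (- (norm1 k * s))) * z * \<zeta>"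
proof -
  have upd: "w(k := x) \<in> space mu_prod" if "cmod x \<le> 1" for x
    using w k that by (auto simp: space_mu_prod PiE_def extensional_def)
  have "k \<noteq> 0" using k by (auto simp: zero_notin_Zstar)
  then have other: "(\<chi> i. int j * k $ i) \<noteq> k" if "j \<noteq> 1" for j
    using that by (simp add: multiple_eq_self_iff)
  have self: "(\<chi> i. int 1 * k $ i) = k" by (simp add: vec_eq_iff)
  have c: "ray_coeff s (w(k := z)) k j * \<zeta> ^ j = ray_coeff s (w(k := 0)) k j * \<zeta> ^ j +
      (if j = 1 then 2 * complex_of_real (exp (- (norm1 k * s))) * z * \<zeta> else 0)" for j
    using other[of j] self by (auto simp: ray_coeff_def)
  have upd0: "w(k := 0) \<in> space mu_prod" by (rule upd) simp
  have "(\<lambda>j. ray_coeff s (w(k := z)) k j * \<zeta> ^ j) sums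
      (ray_series s (w(k := 0)) k \<zeta> + 2 * complex_of_real (exp (- (norm1 k * s))) * z * \<zeta>)"
    unfolding c
    by (rule sums_add[OF ray_series_sums[OF s upd0 k \<zeta>]
        sums_single[of 1 "\<lambda>_. 2 * complex_of_real (exp (- (norm1 k * s))) * z * \<zeta>"]])
  then show ?thesis
    by (rule sums_unique2[OF ray_series_sums[OF s upd[OF z] k \<zeta>]])
qed

section \<open>Almost every family has Morse projections\<close>

text \<open>
  A derivative is the limit of a sequence of difference quotients.
\<close>

lemma borel_measurable_derivative:
  fixes F F' :: "'w \<Rightarrow> real \<Rightarrow> real"
  assumes meas: "\<And>\<theta>. (\<lambda>w. F w \<theta>) \<in> borel_measurable M"
    and der: "\<And>w. w \<in> space M \<Longrightarrow> (F w has_real_derivative F' w \<theta>) (at \<theta>)"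
  shows "(\<lambda>w. F' w \<theta>) \<in> borel_measurable M"
proof (rule borel_measurable_LIMSEQ_real)
  fix w assume "w \<in> space M"
  then have "((\<lambda>h. (F w (\<theta> + h) - F w \<theta>) / h) \<longlongrightarrow> F' w \<theta>) (at 0)"
    using der by (simp add: DERIV_def)
  moreover have "filterlim (\<lambda>n. 1 / real (Suc n)) (at 0) sequentially"
    unfolding filterlim_at using LIMSEQ_inverse_real_of_nat by (simp add: inverse_eq_divide)
  ultimately show "(\<lambda>n. (F w (\<theta> + 1 / real (Suc n)) - F w \<theta>) / (1 / real (Suc n))) \<longlonglongrightarrow> F' w \<theta>"
    by (rule filterlim_compose)
next
  show "(\<lambda>w. (F w (\<theta> + 1 / real (Suc n)) - F w \<theta>) / (1 / real (Suc n))) \<in> borel_measurable M" for n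
    using meas by measurable
qed

text \<open>
  The derivative of order \<open>m\<close> of the projection on the multiples of \<open>k\<close>, as a function of \<open>w\<close>.
\<close>

definition ray_trace ::
    "nat \<Rightarrow> real \<Rightarrow> int ^ 'n::{finite,linorder} \<Rightarrow> (int ^ 'n::{finite,linorder} \<Rightarrow> complex) \<Rightarrow> real \<Rightarrow> real" where
  "ray_trace m s k w = circle_trace ((angular_deriv ^^ m) (ray_series s w k))"

lemma ray_trace_has_derivative:
  assumes "s > 0" "k \<in> Zstar" "w \<in> space mu_prod"
  shows "(ray_trace m s k w has_real_derivative ray_trace (Suc m) s k w \<theta>) (at \<theta>)"
proof -
  have "(angular_deriv ^^ m) (ray_series s w k) holomorphic_on ball 0 (exp (norm1 k * s / 2))"
    using ray_series_holomorphic[of s w k] assms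
    by (induction m) (auto intro!: angular_deriv_holomorphic)
  then show ?thesis
    unfolding ray_trace_def
    using circle_trace_has_derivative sphere_subset_ball_ray[of s w k] assms by fastforce
qed

lemma ray_trace_continuous:
  assumes "s > 0" "k \<in> Zstar" "w \<in> space mu_prod"
  shows "continuous_on UNIV (ray_trace m s k w)"
  using ray_trace_has_derivative[OF assms] by (meson DERIV_isCont continuous_at_imp_continuous_on)

lemma ray_coeff_measurable:
  assumes "k \<in> Zstar"
  shows "(\<lambda>w. ray_coeff s w k j) \<in> borel_measurable mu_prod"
proof (cases "j = 0")
  case False
  then have [measurable]: "(\<lambda>w. w (\<chi> i. int j * k $ i)) \<in> borel_measurable mu_prod"
    using assms by (intro measurable_mu_prod_component multiple_in_Zstar) auto
  show ?thesis
    unfolding ray_coeff_def using False by simp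
qed (simp add: ray_coeff_def)

lemma ray_trace_measurable:
  assumes "s > 0" "k \<in> Zstar"
  shows "(\<lambda>w. ray_trace m s k w \<theta>) \<in> borel_measurable mu_prod"
proof (induction m arbitrary: \<theta>)
  case 0
  note [measurable] = ray_coeff_measurable[OF assms(2)]
  show ?case
    unfolding ray_trace_def circle_trace_def ray_series_def by simp
next
  case (Suc m)
  show ?case
    by (rule borel_measurable_derivative[where F = "ray_trace m s k"])
       (use assms Suc ray_trace_has_derivative in auto)
qed

definition degenerate_set ::
    "real \<Rightarrow> int ^ 'n::{finite,linorder} \<Rightarrow> (int ^ 'n::{finite,linorder} \<Rightarrow> complex) set" where
  "degenerate_set s k = {w \<in> space mu_prod. \<exists>\<theta>. ray_trace 1 s k w \<theta> = 0 \<and> ray_trace 2 s k w \<theta> = 0}"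

text \<open>
  Two points of the circle are equal iff \<open>Re (u * cis \<theta>)\<close> agrees at them for both \<open>u = 1\<close> and
  \<open>u = \<i>\<close>. Splitting the coincidences of critical values by \<open>u\<close> selects, for each of them, a
  direction of the parameter plane in which the two critical values separate.
\<close>

definition coincidence_set ::
    "complex \<Rightarrow> real \<Rightarrow> int ^ 'n::{finite,linorder} \<Rightarrow> (int ^ 'n::{finite,linorder} \<Rightarrow> complex) set" where
  "coincidence_set u s k = {w \<in> space mu_prod. \<exists>\<theta>1 \<theta>2. Re (u * cis \<theta>1) \<noteq> Re (u * cis \<theta>2) \<and>
     ray_trace 1 s k w \<theta>1 = 0 \<and> ray_trace 1 s k w \<theta>2 = 0 \<and> ray_trace 0 s k w \<theta>1 = ray_trace 0 s k w \<theta>2}"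

lemma degenerate_set_measurable:
  assumes "s > 0" "k \<in> Zstar"
  shows "degenerate_set s k \<in> sets mu_prod"
proof -
  have "{w \<in> space mu_prod. \<exists>\<theta>\<in>UNIV. \<bar>ray_trace 1 s k w \<theta>\<bar> + \<bar>ray_trace 2 s k w \<theta>\<bar> = 0} \<in> sets mu_prod"
    using assms by (intro sets_Collect_ex_zero borel_measurable_add borel_measurable_abs ray_trace_measurable
        continuous_on_add continuous_on_rabs ray_trace_continuous) auto
  also have "{w \<in> space mu_prod. \<exists>\<theta>\<in>UNIV. \<bar>ray_trace 1 s k w \<theta>\<bar> + \<bar>ray_trace 2 s k w \<theta>\<bar> = 0} = degenerate_set s k"
    by (auto simp: degenerate_set_def add_nonneg_eq_0_iff)
  finally show ?thesis .
qed

lemma coincidence_set_measurable: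
  assumes "s > 0" "k \<in> Zstar"
  shows "coincidence_set u s k \<in> sets mu_prod"
proof -
  define H where "H = (\<lambda>w p. \<bar>ray_trace 1 s k w (fst p)\<bar> + \<bar>ray_trace 1 s k w (snd p)\<bar> +
      \<bar>ray_trace 0 s k w (fst p) - ray_trace 0 s k w (snd p)\<bar>)"
  \<comment> \<open>The condition that two numbers differ is not closed, but it is a countable union of closed conditions.\<close>
  define S where "S = (\<lambda>m::nat. {p. 1 / Suc m \<le> \<bar>Re (u * cis (fst p)) - Re (u * cis (snd p))\<bar>})"
  have cont: "continuous_on UNIV (\<lambda>p. ray_trace m s k w (f p))"
    if "w \<in> space mu_prod" "continuous_on UNIV f" for m w and f :: "real \<times> real \<Rightarrow> real"
    using continuous_on_compose2[OF ray_trace_continuous[OF assms that(1)] that(2)] by auto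
  have "{w \<in> space mu_prod. \<exists>p\<in>S m. H w p = 0} \<in> sets mu_prod" for m
  proof (rule sets_Collect_ex_zero)
    show "closed (S m)"
      unfolding S_def by (intro closed_Collect_le continuous_intros)
    show "(\<lambda>w. H w p) \<in> borel_measurable mu_prod" for p
      unfolding H_def using ray_trace_measurable[OF assms] by measurable
    show "continuous_on UNIV (H w)" if "w \<in> space mu_prod" for w
      unfolding H_def
      by (intro continuous_on_add continuous_on_diff continuous_on_rabs cont[OF that]
          continuous_on_fst continuous_on_snd continuous_on_id)
  qed
  then have "(\<Union>m. {w \<in> space mu_prod. \<exists>p\<in>S m. H w p = 0}) \<in> sets mu_prod"
    by blast
  also have "(\<Union>m. {w \<in> space mu_prod. \<exists>p\<in>S m. H w p = 0}) = coincidence_set u s k"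
  proof (intro equalityI subsetI)
    fix w assume "w \<in> (\<Union>m. {w \<in> space mu_prod. \<exists>p\<in>S m. H w p = 0})"
    then obtain m p where w: "w \<in> space mu_prod" and p: "p \<in> S m" and H: "H w p = 0" by blast
    have "0 < 1 / real (Suc m)" by simp
    with p have "Re (u * cis (fst p)) \<noteq> Re (u * cis (snd p))"
      unfolding S_def mem_Collect_eq by linarith
    moreover have "ray_trace 1 s k w (fst p) = 0" "ray_trace 1 s k w (snd p) = 0"
        "ray_trace 0 s k w (fst p) = ray_trace 0 s k w (snd p)"
      using H unfolding H_def by linarith+
    ultimately show "w \<in> coincidence_set u s k"
      using w unfolding coincidence_set_def by blast
  next
    fix w assume "w \<in> coincidence_set u s k"
    then obtain \<theta>1 \<theta>2 where w: "w \<in> space mu_prod" "Re (u * cis \<theta>1) \<noteq> Re (u * cis \<theta>2)"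
      "H w (\<theta>1, \<theta>2) = 0"
      unfolding coincidence_set_def H_def by auto
    then obtain m where "1 / real (Suc m) < \<bar>Re (u * cis \<theta>1) - Re (u * cis \<theta>2)\<bar>"
      using nat_approx_posE[of "\<bar>Re (u * cis \<theta>1) - Re (u * cis \<theta>2)\<bar>"] by auto
    then have "(\<theta>1, \<theta>2) \<in> S m" by (simp add: S_def)
    with w show "w \<in> (\<Union>m. {w \<in> space mu_prod. \<exists>p\<in>S m. H w p = 0})" by blast
  qed
  finally show ?thesis .
qed

lemma upd_in_space_mu_prod:
  assumes "w \<in> space mu_prod" "k \<in> Zstar" "cmod z \<le> 1"
  shows "w(k := z) \<in> space mu_prod"
  using assms by (auto simp: space_mu_prod PiE_def extensional_def)

lemma slice_measurable:
  assumes "w \<in> space mu_prod" "k \<in> Zstar" "N \<in> sets mu_prod"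
  shows "{z \<in> cball 0 1. w(k := z) \<in> N} \<in> sets borel"
proof -
  have "(\<lambda>z. w(k := z)) \<in> measurable unit_disc_measure mu_prod"
    unfolding mu_prod_def
    by (rule measurable_fun_upd[where J = Zstar])
       (use assms in \<open>auto simp: mu_prod_def\<close>)
  from measurable_sets[OF this assms(3)] show ?thesis
    by (simp add: sets_unit_disc_measure vimage_def Int_def conj_commute)
qed

lemma null_sets_mu_prodI:
  assumes k: "k \<in> Zstar" and N: "N \<in> sets mu_prod"
    and slice: "\<And>w. w \<in> space mu_prod \<Longrightarrow> {z \<in> cball 0 1. w(k := z) \<in> N} \<in> sets borel \<Longrightarrow>
       {z \<in> cball 0 1. w(k := z) \<in> N} \<in> null_sets lborel"
  shows "N \<in> null_sets mu_prod"
  unfolding mu_prod_def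
proof (rule null_sets_PiM_if_null_slices[OF prob_space_unit_disc_measure k], unfold mu_prod_def[symmetric])
  show "N \<in> sets mu_prod" by (rule N)
  show "{z \<in> space unit_disc_measure. w(k := z) \<in> N} \<in> null_sets unit_disc_measure"
    if "w \<in> space mu_prod" for w
    using slice[OF that slice_measurable[OF that k N]] by (intro null_sets_unit_disc_measureI) auto
qed

lemma Re_mult_cis_has_derivative:
  "((\<lambda>\<theta>. Re (z * cis \<theta>)) has_real_derivative - Im (z * cis \<theta>)) (at \<theta>)"
  "((\<lambda>\<theta>. - Im (z * cis \<theta>)) has_real_derivative - Re (z * cis \<theta>)) (at \<theta>)"
  by (auto intro!: derivative_eq_intros simp: algebra_simps)

lemma ray_trace_upd:
  assumes s: "s > 0" and w: "w \<in> space mu_prod" and k: "k \<in> Zstar" and z: "cmod z \<le> 1"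
  defines "\<rho> \<equiv> 2 * exp (- (norm1 k * s))"
  shows "ray_trace 0 s k (w(k := z)) \<theta> = ray_trace 0 s k (w(k := 0)) \<theta> + \<rho> * Re (z * cis \<theta>)"
    and "ray_trace 1 s k (w(k := z)) \<theta> = ray_trace 1 s k (w(k := 0)) \<theta> - \<rho> * Im (z * cis \<theta>)"
    and "ray_trace 2 s k (w(k := z)) \<theta> = ray_trace 2 s k (w(k := 0)) \<theta> - \<rho> * Re (z * cis \<theta>)"
proof -
  have c: "cmod (cis \<theta>) < exp (norm1 k * s)" for \<theta>
    using norm1_mult_pos[OF s w k] by simp
  have 0: "ray_trace 0 s k (w(k := z)) \<theta> = ray_trace 0 s k (w(k := 0)) \<theta> + \<rho> * Re (z * cis \<theta>)" for \<theta>
    unfolding ray_trace_def circle_trace_def \<rho>_def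
    by (simp add: ray_series_upd[OF s w k z c] mult.assoc)
  note sp = upd_in_space_mu_prod[OF w k z] upd_in_space_mu_prod[OF w k, of 0, simplified]
  have 1: "ray_trace 1 s k (w(k := z)) \<theta> = ray_trace 1 s k (w(k := 0)) \<theta> + \<rho> * (- Im (z * cis \<theta>))" for \<theta>
  proof (rule DERIV_unique)
    show "(ray_trace 0 s k (w(k := z)) has_real_derivative ray_trace 1 s k (w(k := z)) \<theta>) (at \<theta>)"
      using ray_trace_has_derivative[OF s k sp(1), of 0] by simp
    show "(ray_trace 0 s k (w(k := z)) has_real_derivative
        ray_trace 1 s k (w(k := 0)) \<theta> + \<rho> * (- Im (z * cis \<theta>))) (at \<theta>)"
      unfolding 0[abs_def]
      using ray_trace_has_derivative[OF s k sp(2), of 0]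
      by (intro DERIV_add DERIV_cmult Re_mult_cis_has_derivative) simp
  qed
  have 2: "ray_trace 2 s k (w(k := z)) \<theta> = ray_trace 2 s k (w(k := 0)) \<theta> + \<rho> * (- Re (z * cis \<theta>))" for \<theta>
  proof (rule DERIV_unique)
    show "(ray_trace 1 s k (w(k := z)) has_real_derivative ray_trace 2 s k (w(k := z)) \<theta>) (at \<theta>)"
      using ray_trace_has_derivative[OF s k sp(1), of 1] by (simp add: numeral_2_eq_2)
    show "(ray_trace 1 s k (w(k := z)) has_real_derivative
        ray_trace 2 s k (w(k := 0)) \<theta> + \<rho> * (- Re (z * cis \<theta>))) (at \<theta>)"
      unfolding 1[abs_def]
      using ray_trace_has_derivative[OF s k sp(2), of 1]
      by (intro DERIV_add DERIV_cmult Re_mult_cis_has_derivative) (simp add: numeral_2_eq_2)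
  qed
  show "ray_trace 0 s k (w(k := z)) \<theta> = ray_trace 0 s k (w(k := 0)) \<theta> + \<rho> * Re (z * cis \<theta>)"
    and "ray_trace 1 s k (w(k := z)) \<theta> = ray_trace 1 s k (w(k := 0)) \<theta> - \<rho> * Im (z * cis \<theta>)"
    and "ray_trace 2 s k (w(k := z)) \<theta> = ray_trace 2 s k (w(k := 0)) \<theta> - \<rho> * Re (z * cis \<theta>)"
    using 0[of \<theta>] 1[of \<theta>] 2[of \<theta>] unfolding mult_minus_right diff_conv_add_uminus by blast+
qed

text \<open>
  Each slice in the coordinate \<open>k\<close> lies on the curve of degenerate parameters.
\<close>

lemma degenerate_set_null:
  assumes s: "s > 0" and k: "k \<in> Zstar"
  shows "degenerate_set s k \<in> null_sets mu_prod"
proof (rule null_sets_mu_prodI[OF k degenerate_set_measurable[OF s k]])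
  fix w assume w: "w \<in> space mu_prod"
    and meas: "{z \<in> cball 0 1. w(k := z) \<in> degenerate_set s k} \<in> sets borel"
  define \<rho> where "\<rho> = 2 * exp (- (norm1 k * s))"
  let ?w0 = "w(k := 0)"
  have w0: "?w0 \<in> space mu_prod" using upd_in_space_mu_prod[OF w k, of 0] by simp
  have diff: "ray_trace m s k ?w0 differentiable (at x)" for m x
    using ray_trace_has_derivative[OF s k w0] by (auto simp: real_differentiable_def)
  have "\<rho> \<noteq> 0" by (simp add: \<rho>_def)
  from negligible_degenerate_parameters[OF diff diff this]
  have "negligible {z. \<exists>\<theta>. ray_trace 1 s k ?w0 \<theta> - \<rho> * Im (z * cis \<theta>) = 0 \<and>
      ray_trace 2 s k ?w0 \<theta> - \<rho> * Re (z * cis \<theta>) = 0}" .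
  moreover have "{z \<in> cball 0 1. w(k := z) \<in> degenerate_set s k} \<subseteq> {z. \<exists>\<theta>. ray_trace 1 s k ?w0 \<theta> - \<rho> * Im (z * cis \<theta>) = 0 \<and>
      ray_trace 2 s k ?w0 \<theta> - \<rho> * Re (z * cis \<theta>) = 0}"
  proof safe
    fix z assume z: "z \<in> cball 0 1" and "w(k := z) \<in> degenerate_set s k"
    then show "\<exists>\<theta>. ray_trace 1 s k ?w0 \<theta> - \<rho> * Im (z * cis \<theta>) = 0 \<and> ray_trace 2 s k ?w0 \<theta> - \<rho> * Re (z * cis \<theta>) = 0"
      unfolding degenerate_set_def \<rho>_def using ray_trace_upd[OF s w k, of z] by auto
  qed
  ultimately have "{z \<in> cball 0 1. w(k := z) \<in> degenerate_set s k} \<in> null_sets lebesgue"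
    using negligible_subset negligible_iff_null_sets by blast
  then show "{z \<in> cball 0 1. w(k := z) \<in> degenerate_set s k} \<in> null_sets lborel"
    using meas by (subst (asm) null_sets_completion_iff) auto
qed

text \<open>
  Removing the degenerate families turns critical points into local extrema, and on each line of
  direction \<open>u\<close> in the coordinate \<open>k\<close> extremal values with different speeds coincide only countably
  often.
\<close>

lemma coincidence_set_null:
  assumes s: "s > 0" and k: "k \<in> Zstar"
  shows "coincidence_set u s k - degenerate_set s k \<in> null_sets mu_prod"
proof (rule null_sets_mu_prodI[OF k])
  show "coincidence_set u s k - degenerate_set s k \<in> sets mu_prod"
    using coincidence_set_measurable degenerate_set_measurable s k by blast
  fix w assume w: "w \<in> space mu_prod"
    and meas: "{z \<in> cball 0 1. w(k := z) \<in> coincidence_set u s k - degenerate_set s k} \<in> sets borel"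
  define \<rho> where "\<rho> = 2 * exp (- (norm1 k * s))"
  have "\<rho> > 0" by (simp add: \<rho>_def)
  show "{z \<in> cball 0 1. w(k := z) \<in> coincidence_set u s k - degenerate_set s k} \<in> null_sets lborel"
  proof (rule null_sets_if_countable_on_lines[OF meas, where u = u])
    fix z
    define F where "F = (\<lambda>\<theta>. ray_trace 0 s k (w(k := 0)) \<theta> + \<rho> * Re (z * cis \<theta>))"
    define g where "g = (\<lambda>\<theta>. \<rho> * Re (u * cis \<theta>))"
    have "continuous_on UNIV g"
      unfolding g_def by (intro continuous_intros)
    note countable = countable_coincident_extremal_values[OF this, of F]
    show "countable {t. z + t *\<^sub>R u \<in> {z \<in> cball 0 1. w(k := z) \<in> coincidence_set u s k - degenerate_set s k}}"
    proof (rule countable_subset[OF _ countable], intro subsetI CollectI)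
      fix t assume "t \<in> {t. z + t *\<^sub>R u \<in> {z \<in> cball 0 1. w(k := z) \<in> coincidence_set u s k - degenerate_set s k}}"
      then have t: "cmod (z + t *\<^sub>R u) \<le> 1" "w(k := z + t *\<^sub>R u) \<in> coincidence_set u s k"
          "w(k := z + t *\<^sub>R u) \<notin> degenerate_set s k" by auto
      define w' where "w' = w(k := z + t *\<^sub>R u)"
      have w': "w' \<in> space mu_prod" unfolding w'_def by (rule upd_in_space_mu_prod[OF w k t(1)])
      have Fg: "ray_trace 0 s k w' = (\<lambda>\<theta>. F \<theta> + t * g \<theta>)"
        unfolding w'_def ray_trace_upd(1)[OF s w k t(1), abs_def] F_def g_def \<rho>_def
        by (auto simp: algebra_simps)
      have ext: "local_extremum (\<lambda>\<theta>. F \<theta> + t * g \<theta>) \<theta>" if "ray_trace 1 s k w' \<theta> = 0" for \<theta>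
        unfolding Fg[symmetric]
      proof (rule local_extremum_if_nondegenerate)
        show "(ray_trace 0 s k w' has_real_derivative ray_trace 1 s k w' x) (at x)" for x
          using ray_trace_has_derivative[OF s k w', of 0] by simp
        show "(ray_trace 1 s k w' has_real_derivative ray_trace 2 s k w' \<theta>) (at \<theta>)"
          using ray_trace_has_derivative[OF s k w', of 1] by (simp add: numeral_2_eq_2)
        show "ray_trace 2 s k w' \<theta> \<noteq> 0"
          using t(3) that w' unfolding w'_def[symmetric] degenerate_set_def by blast
      qed (rule that)
      obtain \<theta>1 \<theta>2 where \<theta>: "Re (u * cis \<theta>1) \<noteq> Re (u * cis \<theta>2)" "ray_trace 1 s k w' \<theta>1 = 0"
        "ray_trace 1 s k w' \<theta>2 = 0" "ray_trace 0 s k w' \<theta>1 = ray_trace 0 s k w' \<theta>2"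
        using t(2) unfolding w'_def[symmetric] coincidence_set_def by blast
      have "g \<theta>1 \<noteq> g \<theta>2" using \<theta>(1) \<open>\<rho> > 0\<close> by (simp add: g_def)
      then show "\<exists>\<theta>1 \<theta>2. g \<theta>1 \<noteq> g \<theta>2 \<and>
           local_extremum (\<lambda>\<theta>. F \<theta> + t * g \<theta>) \<theta>1 \<and> local_extremum (\<lambda>\<theta>. F \<theta> + t * g \<theta>) \<theta>2 \<and>
           F \<theta>1 + t * g \<theta>1 = F \<theta>2 + t * g \<theta>2"
        using ext[OF \<theta>(2)] ext[OF \<theta>(3)] \<theta>(4) unfolding Fg by blast
    qed
  qed
qed

lemma morse_ray_trace_iff:
  assumes s: "s > 0" and k: "k \<in> Zstar" and w: "w \<in> space mu_prod"
  shows "morse (ray_trace 0 s k w) \<and> distinct_critical_values (ray_trace 0 s k w) \<longleftrightarrow>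
     w \<notin> degenerate_set s k \<and> w \<notin> coincidence_set 1 s k \<and> w \<notin> coincidence_set \<i> s k"
proof -
  have d: "deriv (ray_trace m s k w) = ray_trace (Suc m) s k w" for m
    using ray_trace_has_derivative[OF s k w] by (auto intro: DERIV_imp_deriv)
  have "circle_smooth (ray_trace 0 s k w)"
    using circle_smooth_circle_trace[OF ray_series_holomorphic[OF s w k] open_ball sphere_subset_ball_ray[OF s w k]]
    by (simp add: ray_trace_def)
  then have m: "morse (ray_trace 0 s k w) \<longleftrightarrow> w \<notin> degenerate_set s k"
    using w by (auto simp: morse_def critical_point_def d degenerate_set_def numeral_2_eq_2)
  have eq: "(\<exists>m::int. \<theta>1 - \<theta>2 = 2 * pi * real_of_int m) \<longleftrightarrow>
      Re (1 * cis \<theta>1) = Re (1 * cis \<theta>2) \<and> Re (\<i> * cis \<theta>1) = Re (\<i> * cis \<theta>2)" for \<theta>1 \<theta>2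
    using sin_cos_eq_iff[of \<theta>1 \<theta>2] by (auto simp: algebra_simps)
  have "distinct_critical_values (ray_trace 0 s k w) \<longleftrightarrow> w \<notin> coincidence_set 1 s k \<and> w \<notin> coincidence_set \<i> s k"
    using w unfolding distinct_critical_values_def critical_point_def d eq coincidence_set_def One_nat_def by blast
  with m show ?thesis by blast
qed

lemma morse_rays_measurable:
  assumes s: "s > 0" and k: "k \<in> Zstar"
  shows "{w \<in> space mu_prod. morse (ray_trace 0 s k w) \<and> distinct_critical_values (ray_trace 0 s k w)} \<in> sets mu_prod"
proof -
  have "{w \<in> space mu_prod. morse (ray_trace 0 s k w) \<and> distinct_critical_values (ray_trace 0 s k w)} =
      space mu_prod - degenerate_set s k - coincidence_set 1 s k - coincidence_set \<i> s k"
    using morse_ray_trace_iff[OF s k] by blast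
  then show ?thesis
    using degenerate_set_measurable[OF s k] coincidence_set_measurable[OF s k] by auto
qed

lemma AE_morse_ray:
  assumes s: "s > 0" and k: "k \<in> Zstar"
  shows "AE w in mu_prod. morse (ray_trace 0 s k w) \<and> distinct_critical_values (ray_trace 0 s k w)"
  using AE_not_in[OF degenerate_set_null[OF s k]] AE_not_in[OF coincidence_set_null[OF s k, of 1]]
    AE_not_in[OF coincidence_set_null[OF s k, of \<i>]] AE_space
  by eventually_elim (use morse_ray_trace_iff[OF s k] in blast)

section \<open>Sums over lattices and multi-indices\<close>

lemma summable_on_prod_fun:
  fixes g :: "'a::finite \<Rightarrow> 'b::countable \<Rightarrow> 'c::{real_normed_field,banach,second_countable_topology}"
  assumes "\<And>i. (\<lambda>j. norm (g i j)) summable_on UNIV"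
  shows "(\<lambda>\<alpha>. norm (\<Prod>i\<in>UNIV. g i (\<alpha> i))) summable_on (UNIV :: ('a \<Rightarrow> 'b) set)"
    and "((\<lambda>\<alpha>. \<Prod>i\<in>UNIV. g i (\<alpha> i)) has_sum (\<Prod>i\<in>UNIV. infsum (g i) UNIV)) UNIV"
proof -
  have 1: "Infinite_Set_Sum.abs_summable_on (\<lambda>\<alpha>. \<Prod>i\<in>UNIV. g i (\<alpha> i)) (PiE UNIV (\<lambda>_. UNIV))"
    by (rule abs_summable_on_prod_PiE) (use assms in \<open>auto simp flip: abs_summable_equivalent\<close>)
  then show 2: "(\<lambda>\<alpha>. norm (\<Prod>i\<in>UNIV. g i (\<alpha> i))) summable_on (UNIV :: ('a \<Rightarrow> 'b) set)"
    by (simp add: PiE_UNIV_domain flip: abs_summable_equivalent)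
  have "infsum (\<lambda>\<alpha>. \<Prod>i\<in>UNIV. g i (\<alpha> i)) (PiE UNIV (\<lambda>_. UNIV)) = (\<Prod>i\<in>UNIV. infsum (g i) UNIV)"
    by (rule infsum_prod_PiE_abs) (use assms in auto)
  then have eq: "infsum (\<lambda>\<alpha>. \<Prod>i\<in>UNIV. g i (\<alpha> i)) (UNIV :: ('a \<Rightarrow> 'b) set) = (\<Prod>i\<in>UNIV. infsum (g i) UNIV)"
    by (simp add: PiE_UNIV_domain)
  show "((\<lambda>\<alpha>. \<Prod>i\<in>UNIV. g i (\<alpha> i)) has_sum (\<Prod>i\<in>UNIV. infsum (g i) UNIV)) UNIV"
    using has_sum_infsum[OF abs_summable_summable[OF 2]] unfolding eq .
qed

lemma bij_vec_nth: "bij vec_nth"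
  by (rule bij_betwI[where g = vec_lambda]) auto

text \<open>
  Sums over the lattice are reduced to sums over the integers by comparing with products over the
  coordinates.
\<close>

lemma summable_on_prod_vec:
  fixes g :: "int \<Rightarrow> real"
  assumes "g summable_on UNIV" "\<And>j. g j \<ge> 0"
  shows "(\<lambda>k :: int ^ 'n::finite. \<Prod>i\<in>UNIV. g (k $ i)) summable_on UNIV"
proof -
  have "(\<lambda>\<alpha>. norm (\<Prod>i\<in>UNIV. g (\<alpha> i))) summable_on (UNIV :: ('n \<Rightarrow> int) set)"
    by (rule summable_on_prod_fun(1)) (use assms in simp)
  then have "(\<lambda>\<alpha>. \<Prod>i\<in>UNIV. g (\<alpha> i)) summable_on (UNIV :: ('n \<Rightarrow> int) set)"
    using assms(2) by (simp add: prod_nonneg)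
  then show ?thesis
    using summable_on_reindex_bij_betw[OF bij_vec_nth, of "\<lambda>\<alpha> :: 'n \<Rightarrow> int. \<Prod>i\<in>UNIV. g (\<alpha> i)"] by simp
qed

lemma summable_on_int_abs:
  fixes g :: "nat \<Rightarrow> real"
  assumes g: "summable g" "\<And>n. g n \<ge> 0"
  shows "(\<lambda>j::int. g (nat \<bar>j\<bar>)) summable_on UNIV"
proof -
  have 0: "g summable_on UNIV"
    using g by (simp add: summable_on_UNIV_nonneg_real_iff)
  have 1: "(\<lambda>j::int. g (nat \<bar>j\<bar>)) summable_on range int"
    using 0 by (subst summable_on_reindex) (auto simp: o_def)
  have 2: "(\<lambda>j::int. g (nat \<bar>j\<bar>)) summable_on range (\<lambda>n. - int n)"
    using 0 by (subst summable_on_reindex) (auto simp: o_def inj_on_def)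
  have "(\<lambda>j::int. g (nat \<bar>j\<bar>)) summable_on (range int \<union> (range (\<lambda>n. - int n) - range int))"
    by (intro summable_on_Un_disjoint 1 summable_on_subset[OF 2]) auto
  moreover have "range int \<union> (range (\<lambda>n. - int n) - range int) = UNIV"
  proof (intro equalityI subsetI UNIV_I)
    show "j \<in> range int \<union> (range (\<lambda>n. - int n) - range int)" for j
      by (cases j rule: int_cases2) auto
  qed
  ultimately show ?thesis by simp
qed

lemma summable_exp_norm1:
  assumes "s > 0"
  shows "(\<lambda>k :: int ^ 'n::finite. exp (- (norm1 k * s))) summable_on UNIV"
proof -
  have "(\<lambda>k :: int ^ 'n::finite. \<Prod>i\<in>UNIV. exp (- s) ^ nat \<bar>k $ i\<bar>) summable_on UNIV"
    by (intro summable_on_prod_vec summable_on_int_abs[of "\<lambda>n. exp (- s) ^ n"] summable_geometric)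
       (use assms in auto)
  moreover have "(\<Prod>i\<in>UNIV. exp (- s) ^ nat \<bar>k $ i\<bar>) = exp (- (norm1 k * s))" for k :: "int ^ 'n"
  proof -
    have "exp (- s) ^ nat \<bar>j\<bar> = exp (- (\<bar>real_of_int j\<bar> * s))" for j
      by (simp flip: exp_of_nat_mult)
    then show ?thesis
      by (simp add: norm1_def sum_distrib_right flip: exp_sum sum_negf)
  qed
  ultimately show ?thesis by simp
qed

text \<open>
  Since \<open>norm1 k\<close> is at least the absolute value of each coordinate, the summand is bounded by the product of
  \<open>inverse ((1 + \<bar>k $ i\<bar>) ^ 2)\<close>.
\<close>

lemma summable_norm1_power:
  "(\<lambda>k :: int ^ 'n::finite. inverse ((1 + norm1 k) ^ (2 * CARD('n)))) summable_on UNIV"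
proof -
  have sq: "summable (\<lambda>n. inverse ((1 + real n) ^ 2))"
    using summable_Suc_iff[of "\<lambda>n. inverse (real n ^ 2)"] inverse_power_summable[of 2, where ?'a = real]
    by (simp add: add.commute)
  have "(\<lambda>k :: int ^ 'n. \<Prod>i\<in>UNIV. inverse ((1 + real (nat \<bar>k $ i\<bar>)) ^ 2)) summable_on UNIV"
    by (intro summable_on_prod_vec summable_on_int_abs[of "\<lambda>n. inverse ((1 + real n) ^ 2)"] sq) auto
  then show ?thesis
  proof (rule summable_on_comparison_test)
    fix k :: "int ^ 'n"
    have le: "\<bar>real_of_int (k $ i)\<bar> \<le> norm1 k" for i
      unfolding norm1_def by (rule member_le_sum) auto
    have "(\<Prod>i\<in>(UNIV::'n set). (1 + \<bar>real_of_int (k $ i)\<bar>) ^ 2) \<le> (\<Prod>i\<in>(UNIV::'n set). (1 + norm1 k) ^ 2)"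
      by (intro prod_mono conjI power_mono add_left_mono le) auto
    also have "\<dots> = (1 + norm1 k) ^ (2 * CARD('n))"
      by (simp add: power_mult)
    finally have "inverse ((1 + norm1 k) ^ (2 * CARD('n))) \<le> inverse (\<Prod>i\<in>(UNIV::'n set). (1 + \<bar>real_of_int (k $ i)\<bar>) ^ 2)"
      by (intro le_imp_inverse_le prod_pos) (auto simp: add_pos_nonneg)
    also have "\<dots> = (\<Prod>i\<in>UNIV. inverse ((1 + real (nat \<bar>k $ i\<bar>)) ^ 2))"
      by (simp add: prod_inversef[symmetric] o_def)
    finally show "inverse ((1 + norm1 k) ^ (2 * CARD('n))) \<le> (\<Prod>i\<in>UNIV. inverse ((1 + real (nat \<bar>k $ i\<bar>)) ^ 2))" .
  qed (auto simp: norm1_nonneg)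
qed

text \<open>
  The expansion of a product of exponentials in a multi-indexed power series; with the norms of the
  \<open>z i\<close> in place of \<open>z i\<close> it also evaluates the sum of the norms.
\<close>

lemma has_sum_prod_exp:
  fixes z :: "'a::finite \<Rightarrow> 'c::{real_normed_field,banach,second_countable_topology}"
  shows "((\<lambda>\<alpha>. \<Prod>i\<in>UNIV. z i ^ \<alpha> i / fact (\<alpha> i)) has_sum (\<Prod>i\<in>UNIV. exp (z i))) UNIV"
    and "(\<lambda>\<alpha>. norm (\<Prod>i\<in>UNIV. z i ^ \<alpha> i / fact (\<alpha> i))) summable_on UNIV"
proof -
  have nrm: "norm (z i ^ j / fact j) = norm (norm (z i) ^ j /\<^sub>R fact j)" for i j
    by (simp add: norm_mult norm_inverse norm_power divide_inverse mult.commute)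
  have summ: "summable (\<lambda>j. norm (z i ^ j / fact j))" for i
    unfolding nrm using summable_norm_exp[of "norm (z i)"] by simp
  have sums: "(\<lambda>j. z i ^ j / fact j) sums exp (z i)" for i
    using exp_converges[of "z i"] by (simp add: scaleR_conv_of_real divide_inverse mult.commute)
  have hs: "((\<lambda>j. z i ^ j / fact j) has_sum exp (z i)) UNIV" for i
    by (rule norm_summable_imp_has_sum[OF summ sums])
  have ns: "(\<lambda>j. norm (z i ^ j / fact j)) summable_on UNIV" for i
    using summ by (subst summable_on_UNIV_nonneg_real_iff) auto
  show "((\<lambda>\<alpha>. \<Prod>i\<in>UNIV. z i ^ \<alpha> i / fact (\<alpha> i)) has_sum (\<Prod>i\<in>UNIV. exp (z i))) UNIV"
    using summable_on_prod_fun(2)[of "\<lambda>i j. z i ^ j / fact j", OF ns] infsumI[OF hs] by simp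
  show "(\<lambda>\<alpha>. norm (\<Prod>i\<in>UNIV. z i ^ \<alpha> i / fact (\<alpha> i))) summable_on UNIV"
    using summable_on_prod_fun(1)[of "\<lambda>i j. z i ^ j / fact j", OF ns] .
qed

section \<open>Orthogonality of the characters of the torus\<close>

lemma integral_cis_period:
  assumes "c \<in> \<int>"
  shows "(LINT t:{0..2 * pi}|lborel. cis (c * t)) = (if c = 0 then complex_of_real (2 * pi) else 0)"
proof (cases "c = 0")
  case True
  have "(LINT t:{0..2 * pi}|lborel. (1::complex)) = complex_of_real (2 * pi)"
    by (subst set_integral_const) (auto simp: scaleR_conv_of_real)
  then show ?thesis using True by simp
next
  case False
  obtain m :: int where c: "c = of_int m" using assms by (auto elim: Ints_cases)
  have der: "((\<lambda>t. cis (c * t) / (\<i> * c)) has_vector_derivative cis (c * t)) (at t within {0..2 * pi})" for t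
    unfolding has_vector_derivative_def using False
    by (auto intro!: derivative_eq_intros simp: scaleR_conv_of_real field_simps)
  have "((\<lambda>t. cis (c * t)) has_integral (cis (c * (2 * pi)) / (\<i> * c) - cis (c * 0) / (\<i> * c))) {0..2 * pi}"
    by (rule fundamental_theorem_of_calculus[OF _ der]) auto
  moreover have "cis (c * (2 * pi)) = 1"
    using cis_multiple_2pi[of "real_of_int m"] by (simp add: c mult_ac)
  ultimately have "integral {0..2 * pi} (\<lambda>t. cis (c * t)) = 0"
    by (intro integral_unique) simp
  moreover have "set_integrable lborel {0..2 * pi} (\<lambda>t. cis (c * t))"
    by (intro borel_integrable_atLeastAtMost' continuous_intros)
  ultimately show ?thesis
    using False set_borel_integral_eq_integral(2) by fastforce
qed

lemma integral_lborel_prod: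
  fixes h :: "'a::euclidean_space \<Rightarrow> real \<Rightarrow> complex"
  assumes "\<And>b. b \<in> Basis \<Longrightarrow> integrable lborel (h b)"
  shows "(LINT x|lborel. (\<Prod>b\<in>Basis. h b (x \<bullet> b))) = (\<Prod>b\<in>Basis. (LINT t|lborel. h b t))"
proof -
  interpret product_sigma_finite "\<lambda>_. lborel :: real measure" ..
  have [measurable]: "h b \<in> borel_measurable borel" if "b \<in> Basis" for b
    using borel_measurable_integrable[OF assms[OF that]] by simp
  have "(LINT x|lborel. (\<Prod>b\<in>Basis. h b (x \<bullet> b))) =
      (LINT f|(\<Pi>\<^sub>M b\<in>(Basis::'a set). lborel). (\<Prod>b\<in>Basis. h b ((\<Sum>b\<in>Basis. f b *\<^sub>R b) \<bullet> b)))"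
    by (subst lborel_eq, subst integral_distr) auto
  also have "\<dots> = (LINT f|(\<Pi>\<^sub>M b\<in>(Basis::'a set). lborel). (\<Prod>b\<in>Basis. h b (f b)))"
    by (intro Bochner_Integration.integral_cong prod.cong refl) simp
  also have "\<dots> = (\<Prod>b\<in>Basis. (LINT t|lborel. h b t))"
    by (rule product_integral_prod) (use assms in auto)
  finally show ?thesis .
qed

lemma dotk_eq_inner: "dotk k x = (\<chi> i. real_of_int (k $ i)) \<bullet> x"
  by (simp add: dotk_def inner_vec_def)

lemma cis_sum: "finite A \<Longrightarrow> cis (\<Sum>i\<in>A. f i) = (\<Prod>i\<in>A. cis (f i))"
  by (induction A rule: finite_induct) (auto simp: cis_mult[symmetric])

lemma integral_cis_dotk:
  fixes m :: "int ^ 'n::finite"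
  shows "(LINT x:cbox 0 (\<chi> i. 2 * pi)|lborel. cis (dotk m x)) =
     (if m = 0 then complex_of_real ((2 * pi) ^ CARD('n)) else 0)"
proof -
  define M :: "real ^ 'n" where "M = (\<chi> i. real_of_int (m $ i))"
  define h where "h = (\<lambda>(b :: real ^ 'n) t. indicator {0..2 * pi} t *\<^sub>R cis (M \<bullet> b * t))"
  have h: "(LINT t|lborel. h b t) = (if M \<bullet> b = 0 then complex_of_real (2 * pi) else 0)"
    "integrable lborel (h b)" if b: "b \<in> Basis" for b
  proof -
    obtain i where "b = axis i 1" using b by (auto simp: Basis_vec_def)
    then have "M \<bullet> b \<in> \<int>" by (simp add: M_def inner_axis)
    then show "(LINT t|lborel. h b t) = (if M \<bullet> b = 0 then complex_of_real (2 * pi) else 0)"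
      using integral_cis_period[of "M \<bullet> b"] by (simp add: h_def set_lebesgue_integral_def)
    show "integrable lborel (h b)"
      unfolding h_def by (intro borel_integrable_compact compact_Icc continuous_intros)
  qed
  have two_pi: "(\<chi> i. 2 * pi) \<bullet> b = 2 * pi" if "b \<in> Basis" for b :: "real ^ 'n"
    using that by (auto simp: Basis_vec_def inner_axis)
  have "indicator (cbox 0 (\<chi> i. 2 * pi)) x *\<^sub>R cis (dotk m x) = (\<Prod>b\<in>Basis. h b (x \<bullet> b))" for x :: "real ^ 'n"
  proof (cases "x \<in> cbox 0 (\<chi> i. 2 * pi)")
    case True
    then have "x \<bullet> b \<in> {0..2 * pi}" if "b \<in> Basis" for b
      using that two_pi[OF that] by (auto simp: mem_box)
    then have "(\<Prod>b\<in>Basis. h b (x \<bullet> b)) = (\<Prod>b\<in>Basis. cis (M \<bullet> b * (x \<bullet> b)))"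
      by (intro prod.cong) (auto simp: h_def)
    also have "\<dots> = cis (dotk m x)"
      by (simp add: dotk_eq_inner M_def[symmetric] euclidean_inner[of M x] cis_sum)
    finally show ?thesis using True by simp
  next
    case False
    then obtain b where b: "b \<in> Basis" "x \<bullet> b \<notin> {0..2 * pi}"
      using two_pi by (auto simp: mem_box)
    then have "(\<Prod>b\<in>Basis. h b (x \<bullet> b)) = 0"
      by (intro prod_zero) (auto simp: h_def intro!: bexI[of _ b])
    then show ?thesis using False by simp
  qed
  then have "(LINT x:cbox 0 (\<chi> i. 2 * pi)|lborel. cis (dotk m x)) = (LINT x|lborel. (\<Prod>b\<in>Basis. h b (x \<bullet> b)))"
    by (simp add: set_lebesgue_integral_def)
  also have "\<dots> = (\<Prod>b\<in>(Basis :: (real ^ 'n) set). (LINT t|lborel. h b t))"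
    by (rule integral_lborel_prod) (rule h)
  also have "\<dots> = (\<Prod>b\<in>(Basis :: (real ^ 'n) set). if M \<bullet> b = 0 then complex_of_real (2 * pi) else 0)"
    by (intro prod.cong refl) (rule h(1))
  also have "\<dots> = (if m = 0 then complex_of_real ((2 * pi) ^ CARD('n)) else 0)"
  proof (cases "m = 0")
    case True
    then have "M = 0" by (simp add: M_def vec_eq_iff)
    then show ?thesis using True by simp
  next
    case False
    then have "M \<noteq> 0" by (auto simp: M_def vec_eq_iff)
    then obtain b where "b \<in> Basis" "M \<bullet> b \<noteq> 0" using euclidean_eqI[of M 0] by auto
    then show ?thesis using False by (auto intro!: prod_zero)
  qed
  finally show ?thesis .
qed

section \<open>Every family of coefficients comes from a real analytic function\<close>

lemma obtain_enumeration:
  obtains e :: "nat \<Rightarrow> int ^ 'n::finite" where "bij e"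
proof -
  have "infinite (UNIV :: (int ^ 'n) set)"
  proof
    assume "finite (UNIV :: (int ^ 'n) set)"
    then have "finite (range (\<lambda>j::int. (\<chi> i. j) :: int ^ 'n))" by (rule finite_subset[rotated]) simp
    moreover have "inj (\<lambda>j::int. (\<chi> i. j) :: int ^ 'n)" by (auto simp: inj_on_def vec_eq_iff)
    ultimately show False using finite_imageD infinite_UNIV_int by blast
  qed
  then have "bij_betw (from_nat_into (UNIV :: (int ^ 'n) set)) UNIV UNIV"
    by (intro bij_betw_from_nat_into) auto
  then show ?thesis by (rule that)
qed

definition synthesis ::
    "real \<Rightarrow> (int ^ 'n::{finite,linorder} \<Rightarrow> complex) \<Rightarrow> real ^ 'n::{finite,linorder} \<Rightarrow> real" where
  "synthesis s w x = Re (\<Sum>\<^sub>\<infinity>k. mode_coeff s w k * cis (dotk k x))"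

context
  fixes s :: real and w :: "int ^ 'n::{finite,linorder} \<Rightarrow> complex"
  assumes s: "s > 0" and w: "w \<in> space mu_prod"
begin

lemma mode_coeff_abs_summable: "(\<lambda>k. norm (mode_coeff s w k)) summable_on UNIV"
  by (rule summable_on_comparison_test[OF summable_exp_norm1[OF s]])
     (use mode_coeff_bound[OF w, of s] in auto)

text \<open>
  The sum is real because exchanging \<open>k\<close> and \<open>- k\<close> conjugates the terms.
\<close>

lemma synthesis_has_sum:
  "((\<lambda>k. mode_coeff s w k * cis (dotk k x)) has_sum complex_of_real (synthesis s w x)) UNIV"
proof -
  let ?g = "\<lambda>k. mode_coeff s w k * cis (dotk k x)"
  have "(\<lambda>k. norm (?g k)) summable_on UNIV"
    using mode_coeff_abs_summable by (simp add: norm_mult)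
  then have S: "(?g has_sum infsum ?g UNIV) UNIV"
    by (rule has_sum_infsum[OF abs_summable_summable])
  have "bij (uminus :: int ^ 'n::{finite,linorder} \<Rightarrow> _)"
    by (rule bij_betwI[where g = uminus]) auto
  then have "((\<lambda>k. ?g (- k)) has_sum infsum ?g UNIV) UNIV"
    using S has_sum_reindex_bij_betw[of uminus UNIV UNIV ?g] by blast
  moreover have "?g (- k) = cnj (?g k)" for k
    by (simp add: mode_coeff_uminus dotk_uminus cis_cnj)
  ultimately have "((\<lambda>k. cnj (?g k)) has_sum infsum ?g UNIV) UNIV"
    by simp
  moreover have "((\<lambda>k. cnj (?g k)) has_sum cnj (infsum ?g UNIV)) UNIV"
    using S by (simp only: has_sum_cnj_iff)
  ultimately have "cnj (infsum ?g UNIV) = infsum ?g UNIV"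
    using has_sum_unique by blast
  then have "infsum ?g UNIV = complex_of_real (synthesis s w x)"
    unfolding synthesis_def by (metis Reals_cnj_iff of_real_Re)
  with S show ?thesis by simp
qed

lemma torus_periodic_synthesis: "torus_periodic (synthesis s w)"
proof -
  have "cis (dotk k (\<chi> i. x $ i + 2 * pi * real_of_int (m $ i))) = cis (dotk k x)"
    for k m :: "int ^ 'n::{finite,linorder}" and x :: "real ^ 'n::{finite,linorder}"
  proof -
    have "dotk k (\<chi> i. x $ i + 2 * pi * real_of_int (m $ i)) =
        dotk k x + 2 * pi * real_of_int (\<Sum>i\<in>UNIV. k $ i * m $ i)"
      by (simp add: dotk_def algebra_simps sum.distrib sum_distrib_left)
    then show ?thesis
      by (simp add: cis_multiple_2pi del: of_int_sum of_int_mult flip: cis_mult)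
  qed
  then show ?thesis by (simp add: torus_periodic_def synthesis_def)
qed

text \<open>
  The series converges absolutely and uniformly, so it may be integrated term by term against a
  character, and orthogonality leaves a single term.
\<close>

lemma fourier_coeff_synthesis: "fourier_coeff (synthesis s w) k = mode_coeff s w k"
proof -
  let ?C = "cbox 0 (\<chi> i. 2 * pi) :: (real ^ 'n::{finite,linorder}) set"
  let ?V = "complex_of_real ((2 * pi) ^ CARD('n))"
  obtain e :: "nat \<Rightarrow> int ^ 'n::{finite,linorder}" where e: "bij e"
    by (rule obtain_enumeration)
  let ?a = "\<lambda>i. mode_coeff s w (e i)"
  define F where "F = (\<lambda>i x. indicator ?C x *\<^sub>R (?a i * cis (dotk (e i - k) x)))"
  have a: "summable (\<lambda>i. norm (?a i))"
    using summable_on_reindex_bij_betw[OF e, of "\<lambda>k. norm (mode_coeff s w k)"] mode_coeff_abs_summable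
    by (intro summable_on_imp_summable) simp
  have dotk_cont: "continuous_on A (\<lambda>x. cis (dotk m x))" for m :: "int ^ 'n::{finite,linorder}" and A
    unfolding dotk_def by (intro continuous_intros)
  have int: "integrable lborel (F i)" for i
    unfolding F_def by (intro borel_integrable_compact compact_cbox continuous_on_mult continuous_on_const dotk_cont)
  have norm_F: "norm (F i x) = indicator ?C x * norm (?a i)" for i x
    by (auto simp: F_def norm_mult indicator_def)
  have "(\<lambda>i. integral\<^sup>L lborel (F i)) sums (\<integral>x. (\<Sum>i. F i x) \<partial>lborel)"
  proof (rule sums_integral[OF int])
    show "AE x in lborel. summable (\<lambda>i. norm (F i x))"
      unfolding norm_F by (intro AE_I2 summable_mult a)
    show "summable (\<lambda>i. \<integral>x. norm (F i x) \<partial>lborel)"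
      unfolding norm_F using a by (simp add: summable_mult)
  qed
  moreover have "(\<Sum>i. F i x) = indicator ?C x *\<^sub>R (complex_of_real (synthesis s w x) * cis (- dotk k x))" for x
  proof -
    have "((\<lambda>i. ?a i * cis (dotk (e i) x)) has_sum complex_of_real (synthesis s w x)) UNIV"
      using synthesis_has_sum[of x] has_sum_reindex_bij_betw[OF e, of "\<lambda>k. mode_coeff s w k * cis (dotk k x)"] by blast
    then have "(\<lambda>i. ?a i * cis (dotk (e i) x)) sums complex_of_real (synthesis s w x)"
      by (rule has_sum_imp_sums)
    then have "(\<lambda>i. indicator ?C x *\<^sub>R (?a i * cis (dotk (e i) x) * cis (- dotk k x))) sums
        (indicator ?C x *\<^sub>R (complex_of_real (synthesis s w x) * cis (- dotk k x)))"
      by (intro sums_scaleR_right sums_mult2)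
    moreover have "indicator ?C x *\<^sub>R (?a i * cis (dotk (e i) x) * cis (- dotk k x)) = F i x" for i
      by (simp add: F_def dotk_def cis_mult sum_subtractf algebra_simps del: cis_neq_zero)
    ultimately show ?thesis by (simp add: sums_iff)
  qed
  ultimately have "(\<lambda>i. integral\<^sup>L lborel (F i)) sums
      (LINT x:?C|lborel. complex_of_real (synthesis s w x) * cis (- dotk k x))"
    by (simp add: set_lebesgue_integral_def)
  moreover have "(\<lambda>i. integral\<^sup>L lborel (F i)) sums (mode_coeff s w k * ?V)"
  proof -
    obtain i0 where i0: "e i0 = k" using e by (metis bij_pointE)
    have "integral\<^sup>L lborel (F i) = (if i = i0 then mode_coeff s w k * ?V else 0)" for i
    proof -
      have "integral\<^sup>L lborel (F i) = (LINT x:?C|lborel. ?a i * cis (dotk (e i - k) x))"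
        unfolding F_def set_lebesgue_integral_def ..
      also have "\<dots> = ?a i * (LINT x:?C|lborel. cis (dotk (e i - k) x))"
        by (rule set_integral_mult_right)
      also have "\<dots> = (if e i = k then ?a i * ?V else 0)"
        by (simp add: integral_cis_dotk)
      also have "e i = k \<longleftrightarrow> i = i0" using e i0 by (metis bij_pointE)
      finally show ?thesis using i0 by auto
    qed
    then show ?thesis using sums_single[of i0 "\<lambda>_. mode_coeff s w k * ?V"] by simp
  qed
  ultimately have "(LINT x:?C|lborel. complex_of_real (synthesis s w x) * cis (- dotk k x)) = mode_coeff s w k * ?V"
    using sums_unique2 by blast
  then show ?thesis by (simp add: fourier_coeff_def)
qed

text \<open>
  In \<open>cis (dotk k x) = cis (dotk k x0) * cis (dotk k y)\<close> with \<open>y = x - x0\<close>, expand the second factor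
  in powers of the coordinates of \<open>y\<close>. The norms of the terms of this expansion add up to
  \<open>exp (\<Sum>i. \<bar>k $ i\<bar> * \<bar>y $ i\<bar>)\<close>, which is at most \<open>exp (norm1 k * (s / 2))\<close> as long as the
  coordinates of \<open>y\<close> stay below \<open>s / 2\<close>. The decay \<open>exp (- (norm1 k * s))\<close> of the coefficients
  absorbs this, so the double series over \<open>k\<close> and the multi-index converges absolutely, and summing
  over \<open>k\<close> first gives the power series.
\<close>

lemma real_analytic_synthesis: "real_analytic (synthesis s w)"
  unfolding real_analytic_def
proof (intro allI)
  fix x0 :: "real ^ 'n::{finite,linorder}"
  define a where "a = (\<lambda>k. mode_coeff s w k * cis (dotk k x0))"
  define p where "p = (\<lambda>k (\<alpha> :: 'n \<Rightarrow> nat). \<Prod>i\<in>UNIV. (\<i> * of_int (k $ i)) ^ \<alpha> i / fact (\<alpha> i))"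
  define c where "c = (\<lambda>\<alpha>. Re (\<Sum>\<^sub>\<infinity>k. a k * p k \<alpha>))"
  show "\<exists>r>0. \<exists>c. \<forall>x. (\<forall>i. \<bar>x $ i - x0 $ i\<bar> < r) \<longrightarrow>
      ((\<lambda>\<alpha>. c \<alpha> * (\<Prod>i\<in>UNIV. (x $ i - x0 $ i) ^ \<alpha> i)) has_sum synthesis s w x) UNIV"
  proof (rule exI[of _ "s / 2"], rule conjI, use s in simp, rule exI[of _ c], intro allI impI)
    fix x assume x: "\<forall>i. \<bar>x $ i - x0 $ i\<bar> < s / 2"
    define y where "y = x - x0"
    have y: "\<bar>y $ i\<bar> \<le> s / 2" for i using x[rule_format, of i] by (simp add: y_def)
    define q where "q = (\<lambda>k (\<alpha> :: 'n \<Rightarrow> nat). \<Prod>i\<in>UNIV. (\<i> * of_int (k $ i) * of_real (y $ i)) ^ \<alpha> i / fact (\<alpha> i))"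
    define Y where "Y = (\<lambda>\<alpha> :: 'n \<Rightarrow> nat. \<Prod>i\<in>UNIV. (y $ i) ^ \<alpha> i)"
    have qp: "q k \<alpha> = p k \<alpha> * of_real (Y \<alpha>)" for k \<alpha>
      by (simp add: q_def p_def Y_def power_mult_distrib flip: prod.distrib)
    have q_sum: "(q k has_sum cis (dotk k y)) UNIV" for k
    proof -
      have "exp (\<i> * of_int (k $ i) * of_real (y $ i)) = cis (real_of_int (k $ i) * y $ i)" for i
        by (simp add: cis_conv_exp mult_ac)
      then have "(\<Prod>i\<in>UNIV. exp (\<i> * of_int (k $ i) * of_real (y $ i))) = cis (dotk k y)"
        by (simp add: dotk_def cis_sum)
      then show ?thesis
        unfolding q_def using has_sum_prod_exp(1)[of "\<lambda>i. \<i> * of_int (k $ i) * of_real (y $ i)"] by simp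
    qed
    have norm_q: "norm (q k \<alpha>) = (\<Prod>i\<in>UNIV. (\<bar>real_of_int (k $ i)\<bar> * \<bar>y $ i\<bar>) ^ \<alpha> i / fact (\<alpha> i))" for k \<alpha>
      by (simp add: q_def norm_mult norm_divide norm_power prod_norm[symmetric])
    have norm_q_sum: "((\<lambda>\<alpha>. norm (q k \<alpha>)) has_sum (\<Prod>i\<in>UNIV. exp (\<bar>real_of_int (k $ i)\<bar> * \<bar>y $ i\<bar>))) UNIV" for k
      unfolding norm_q by (rule has_sum_prod_exp(1))
    have abs: "(\<lambda>z. norm (a (fst z) * q (fst z) (snd z))) summable_on (UNIV \<times> UNIV)"
    proof (rule Infinite_Sum.abs_summable_on_Sigma_iff[THEN iffD2], intro conjI ballI)
      show "(\<lambda>\<alpha>. norm (a (fst (k, \<alpha>)) * q (fst (k, \<alpha>)) (snd (k, \<alpha>)))) summable_on UNIV" for k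
        using has_sum_imp_summable[OF norm_q_sum[of k]] by (simp add: norm_mult summable_on_cmult_right)
      have "(\<Sum>\<^sub>\<infinity>\<alpha>. norm (a k * q k \<alpha>)) \<le> exp (- (norm1 k * (s / 2)))" for k
      proof -
        have "(\<Sum>\<^sub>\<infinity>\<alpha>. norm (a k * q k \<alpha>)) = norm (a k) * (\<Prod>i\<in>UNIV. exp (\<bar>real_of_int (k $ i)\<bar> * \<bar>y $ i\<bar>))"
          using infsumI[OF norm_q_sum[of k]] by (simp add: norm_mult infsum_cmult_right')
        also have "\<dots> \<le> exp (- (norm1 k * s)) * (\<Prod>i\<in>UNIV. exp (\<bar>real_of_int (k $ i)\<bar> * (s / 2)))"
        proof (intro mult_mono prod_mono conjI prod_nonneg)
          show "norm (a k) \<le> exp (- (norm1 k * s))"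
            using mode_coeff_bound[OF w, of s k] by (simp add: a_def norm_mult)
          show "exp (\<bar>real_of_int (k $ i)\<bar> * \<bar>y $ i\<bar>) \<le> exp (\<bar>real_of_int (k $ i)\<bar> * (s / 2))" for i
            unfolding exp_le_cancel_iff by (intro mult_left_mono y) simp
        qed auto
        also have "(\<Prod>i\<in>UNIV. exp (\<bar>real_of_int (k $ i)\<bar> * (s / 2))) = exp (norm1 k * (s / 2))"
          by (simp add: norm1_def sum_distrib_right flip: exp_sum)
        also have "exp (- (norm1 k * s)) * exp (norm1 k * (s / 2)) = exp (- (norm1 k * (s / 2)))"
          by (simp flip: exp_add)
        finally show ?thesis .
      qed
      then show "(\<lambda>k. norm (\<Sum>\<^sub>\<infinity>\<alpha>. norm (a (fst (k, \<alpha>)) * q (fst (k, \<alpha>)) (snd (k, \<alpha>))))) summable_on UNIV"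
        using s by (intro summable_on_comparison_test[OF summable_exp_norm1[of "s / 2"]])
          (auto simp: infsum_nonneg)
    qed
    have "((\<lambda>z. a (fst z) * q (fst z) (snd z)) has_sum complex_of_real (synthesis s w x)) (UNIV \<times> UNIV)"
    proof (rule has_sum_SigmaI)
      show "((\<lambda>\<alpha>. a (fst (k, \<alpha>)) * q (fst (k, \<alpha>)) (snd (k, \<alpha>))) has_sum a k * cis (dotk k y)) UNIV" for k
        using has_sum_cmult_right[OF q_sum[of k], of "a k"] by simp
      have "dotk k x0 + dotk k y = dotk k x" for k
        by (simp add: dotk_def y_def algebra_simps flip: sum.distrib)
      then have "a k * cis (dotk k y) = mode_coeff s w k * cis (dotk k x)" for k
        by (simp add: a_def cis_mult mult.assoc)
      then show "((\<lambda>k. a k * cis (dotk k y)) has_sum complex_of_real (synthesis s w x)) UNIV"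
        using synthesis_has_sum by simp
      show "(\<lambda>z. a (fst z) * q (fst z) (snd z)) summable_on UNIV \<times> UNIV"
        by (rule abs_summable_summable[OF abs])
    qed
    then have swapped: "((\<lambda>(\<alpha>, k). a k * q k \<alpha>) has_sum complex_of_real (synthesis s w x)) (UNIV \<times> UNIV)"
      by (subst (asm) has_sum_swap) simp
    have "(\<lambda>(\<alpha>, k). a k * q k \<alpha>) summable_on (UNIV \<times> UNIV)"
      using has_sum_imp_summable[OF swapped] .
    then have "(\<lambda>k. a k * q k \<alpha>) summable_on UNIV" for \<alpha>
      using summable_on_SigmaD1[where f = "\<lambda>\<alpha> k. a k * q k \<alpha>"] by blast
    then have "((\<lambda>k. a k * q k \<alpha>) has_sum (\<Sum>\<^sub>\<infinity>k. a k * q k \<alpha>)) UNIV" for \<alpha>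
      by (rule has_sum_infsum)
    then have "((\<lambda>\<alpha>. \<Sum>\<^sub>\<infinity>k. a k * q k \<alpha>) has_sum complex_of_real (synthesis s w x)) UNIV"
      by (intro has_sum_SigmaD[OF swapped]) simp
    moreover have "(\<Sum>\<^sub>\<infinity>k. a k * q k \<alpha>) = (\<Sum>\<^sub>\<infinity>k. a k * p k \<alpha>) * of_real (Y \<alpha>)" for \<alpha>
      by (simp add: qp infsum_cmult_left' flip: mult.assoc)
    ultimately have "((\<lambda>\<alpha>. Re ((\<Sum>\<^sub>\<infinity>k. a k * p k \<alpha>) * of_real (Y \<alpha>))) has_sum synthesis s w x) UNIV"
      using has_sum_Re by fastforce
    moreover have Re_mult_of_real: "Re (z * of_real t) = Re z * t" for z t by simp
    ultimately show "((\<lambda>\<alpha>. c \<alpha> * (\<Prod>i\<in>UNIV. (x $ i - x0 $ i) ^ \<alpha> i)) has_sum synthesis s w x) UNIV"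
      unfolding Re_mult_of_real by (simp add: c_def Y_def y_def)
  qed
qed

lemma synthesis_in_BB: "synthesis s w \<in> BB s"
proof -
  have "cmod (mode_coeff s w k) * exp (norm1 k * s) \<le> 1" for k
    using mult_right_mono[OF mode_coeff_bound[OF w, of s k], of "exp (norm1 k * s)"]
    by (simp flip: exp_add)
  then have "fourier_norm s (synthesis s w) \<le> 1"
    unfolding fourier_norm_def fourier_coeff_synthesis by (intro SUP_least) simp
  then show ?thesis
    unfolding BB_def
    using torus_periodic_synthesis real_analytic_synthesis synthesis_has_sum
    by (simp add: fourier_coeff_synthesis mode_coeff_zero)
qed

lemma fourier_map_synthesis: "fourier_map s (synthesis s w) = w"
proof (rule ext)
  fix k :: "int ^ 'n::{finite,linorder}"
  have "complex_of_real (exp (- norm1 k * s)) * complex_of_real (exp (norm1 k * s)) = 1"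
    by (simp flip: of_real_mult exp_add)
  then show "fourier_map s (synthesis s w) k = w k"
    using w by (auto simp: fourier_map_def fourier_coeff_synthesis mode_coeff_def mult.assoc
        space_mu_prod PiE_def extensional_def)
qed

end

section \<open>The lower bound on the coefficients\<close>

text \<open>
  Positivity of the lower limit as a countable combination of conditions on single coefficients, which
  is the form needed for measurability. It is also correct for the trivial filter of the
  one-dimensional case, where the right-hand side holds for any \<open>N\<close> larger than the norm of the only
  generator.
\<close>

lemma Liminf_generators_pos_iff:
  fixes g :: "int ^ 'n::{finite,linorder} \<Rightarrow> real"
  shows "Liminf (inf (filtercomap norm1 at_top) (principal GG_gen)) (\<lambda>k. ereal (g k)) > 0 \<longleftrightarrow>
     (\<exists>m N :: nat. \<forall>k\<in>GG_gen. norm1 k \<ge> real N \<longrightarrow> g k \<ge> 1 / real (Suc m))"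
    (is "0 < Liminf ?F _ \<longleftrightarrow> ?R")
proof -
  have ev: "eventually P ?F \<longleftrightarrow> (\<exists>N::nat. \<forall>k\<in>GG_gen. norm1 k \<ge> real N \<longrightarrow> P k)" for P
  proof
    assume "eventually P ?F"
    then obtain B where B: "\<And>k. norm1 k \<ge> B \<Longrightarrow> k \<in> GG_gen \<Longrightarrow> P k"
      unfolding eventually_inf_principal eventually_filtercomap_at_top_linorder by auto
    obtain N :: nat where "B \<le> real N" using real_arch_simple by blast
    then show "\<exists>N::nat. \<forall>k\<in>GG_gen. norm1 k \<ge> real N \<longrightarrow> P k"
      using B by (intro exI[of _ N]) force
  next
    assume "\<exists>N::nat. \<forall>k\<in>GG_gen. norm1 k \<ge> real N \<longrightarrow> P k"
    then show "eventually P ?F"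
      unfolding eventually_inf_principal eventually_filtercomap_at_top_linorder by auto
  qed
  show ?thesis
  proof
    assume "0 < Liminf ?F (\<lambda>k. ereal (g k))"
    then obtain e where e: "0 < ereal e" "ereal e < Liminf ?F (\<lambda>k. ereal (g k))"
      using ereal_dense2 by blast
    then obtain N :: nat where N: "\<forall>k\<in>GG_gen. norm1 k \<ge> real N \<longrightarrow> ereal e < ereal (g k)"
      using less_LiminfD[OF e(2)] unfolding ev by blast
    obtain m where "1 / real (Suc m) < e"
      using nat_approx_posE[of e] e(1) by auto
    with N show ?R by (intro exI[of _ m] exI[of _ N]) force
  next
    assume ?R
    then obtain m N :: nat where "\<forall>k\<in>GG_gen. norm1 k \<ge> real N \<longrightarrow> g k \<ge> 1 / real (Suc m)" by blast
    then have "eventually (\<lambda>k. ereal (1 / real (Suc m)) \<le> ereal (g k)) ?F"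
      unfolding ev by auto
    then have "ereal (1 / real (Suc m)) \<le> Liminf ?F (\<lambda>k. ereal (g k))"
      by (rule Liminf_bounded)
    moreover have "0 < ereal (1 / real (Suc m))" by simp
    ultimately show "0 < Liminf ?F (\<lambda>k. ereal (g k))" by (rule less_le_trans[rotated])
  qed
qed

definition lower_bounded_set :: "(int ^ 'n::{finite,linorder} \<Rightarrow> complex) set" where
  "lower_bounded_set = {w \<in> space mu_prod. \<exists>m N :: nat. \<forall>k\<in>GG_gen. norm1 k \<ge> real N \<longrightarrow>
     cmod (w k) * norm1 k ^ CARD('n) \<ge> 1 / real (Suc m)}"

lemma GG_gen_subset: "GG_gen \<subseteq> Zstar"
  by (auto simp: GG_gen_def)

lemma lower_bounded_set_measurable: "lower_bounded_set \<in> sets mu_prod"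
proof -
  have [measurable]: "(\<lambda>w. w k) \<in> borel_measurable mu_prod" if "k \<in> GG_gen" for k
    using that GG_gen_subset by (intro measurable_mu_prod_component) blast
  show ?thesis
    unfolding lower_bounded_set_def by measurable
qed

lemma emeasure_component_small:
  assumes k: "k \<in> Zstar" and r: "0 \<le> r" "r \<le> 1"
  shows "emeasure mu_prod {w \<in> space mu_prod. cmod (w k) < r} \<le> ennreal (r ^ 2)"
proof -
  have A: "{z \<in> space unit_disc_measure. cmod z < r} = ball 0 r"
    using r by auto
  have "emeasure mu_prod {w \<in> space mu_prod. cmod (w k) < r} =
      emeasure unit_disc_measure {z \<in> space unit_disc_measure. cmod z < r}"
  proof -
    have comp: "(\<lambda>w. w k) \<in> measurable mu_prod unit_disc_measure"
      unfolding mu_prod_def by (rule measurable_component_singleton[OF k])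
    have "distr mu_prod unit_disc_measure (\<lambda>w. w k) = unit_disc_measure"
      unfolding mu_prod_def
      by (rule distr_PiM_component[OF prob_space_unit_disc_measure k])
    then have "emeasure unit_disc_measure (ball 0 r) = emeasure (distr mu_prod unit_disc_measure (\<lambda>w. w k)) (ball 0 r)"
      by simp
    also have "\<dots> = emeasure mu_prod ((\<lambda>w. w k) -` ball 0 r \<inter> space mu_prod)"
      by (rule emeasure_distr[OF comp]) (use r in \<open>auto simp: sets_unit_disc_measure\<close>)
    also have "(\<lambda>w. w k) -` ball 0 r \<inter> space mu_prod = {w \<in> space mu_prod. cmod (w k) < r}"
      by auto
    finally show ?thesis using A by simp
  qed
  also have "\<dots> = emeasure lborel (ball (0::complex) r) / ennreal pi"
    unfolding A using r by (intro emeasure_unit_disc_measure) auto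
  also have "\<dots> = ennreal (r ^ 2)"
    using r by (simp add: emeasure_ball unit_ball_vol_2 divide_ennreal)
  finally show ?thesis by simp
qed

text \<open>
  The Borel-Cantelli lemma for the events \<open>cmod (w k) < 1 / norm1 k ^ n\<close>, whose probabilities are
  summable over the lattice.
\<close>

lemma AE_lower_bounded: "AE w in mu_prod. w \<in> (lower_bounded_set :: (int ^ 'n::{finite,linorder} \<Rightarrow> complex) set)"
proof -
  interpret prob_space "mu_prod :: (int ^ 'n::{finite,linorder} \<Rightarrow> complex) measure"
    by (rule prob_space_mu_prod)
  let ?G = "GG_gen :: (int ^ 'n::{finite,linorder}) set"
  define r where "r = (\<lambda>k :: int ^ 'n::{finite,linorder}. 1 / norm1 k ^ CARD('n))"
  define A where "A = (\<lambda>k. if k \<in> ?G then {w \<in> space mu_prod. cmod (w k) < r k} else {})"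
  have four: "(2::real) ^ (2 * CARD('n)) = 4 ^ CARD('n)" by (simp add: power_mult)
  have norm: "norm1 k \<ge> 1" if "k \<in> ?G" for k
    using that GG_gen_subset zero_notin_Zstar by (intro norm1_ge_1) blast
  have A_sets [measurable]: "A k \<in> sets mu_prod" for k
  proof (cases "k \<in> ?G")
    case True
    then have [measurable]: "(\<lambda>w. w k) \<in> borel_measurable mu_prod"
      using GG_gen_subset by (intro measurable_mu_prod_component) blast
    show ?thesis using True by (simp add: A_def)
  qed (simp add: A_def)
  \<comment> \<open>\<open>norm1 k \<ge> (1 + norm1 k) / 2\<close> allows a comparison with a series that is also defined at \<open>k = 0\<close>.\<close>
  have A_le: "measure mu_prod (A k) \<le> 4 ^ CARD('n) * inverse ((1 + norm1 k) ^ (2 * CARD('n)))" for k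
  proof (cases "k \<in> ?G")
    case True
    have r: "0 \<le> r k" "r k \<le> 1" using norm[OF True] by (auto simp: r_def)
    have "emeasure mu_prod (A k) \<le> ennreal (r k ^ 2)"
      using emeasure_component_small[OF _ r] True GG_gen_subset by (auto simp: A_def)
    then have "measure mu_prod (A k) \<le> r k ^ 2"
      by (simp add: emeasure_eq_measure)
    also have "\<dots> = inverse (norm1 k ^ (2 * CARD('n)))"
      by (simp add: r_def power_divide inverse_eq_divide mult.commute flip: power_mult)
    also have "\<dots> \<le> inverse (((1 + norm1 k) / 2) ^ (2 * CARD('n)))"
      using norm[OF True] by (intro le_imp_inverse_le power_mono) auto
    also have "\<dots> = 4 ^ CARD('n) * inverse ((1 + norm1 k) ^ (2 * CARD('n)))"
      using four by (simp add: power_divide field_simps)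
    finally show ?thesis .
  qed (simp add: A_def norm1_nonneg)
  obtain e :: "nat \<Rightarrow> int ^ 'n::{finite,linorder}" where e: "bij e"
    by (rule obtain_enumeration)
  have "summable (\<lambda>i. measure mu_prod (A (e i)))"
  proof -
    have "(\<lambda>k. measure mu_prod (A k)) summable_on UNIV"
      by (rule summable_on_comparison_test[OF summable_on_cmult_right[OF summable_norm1_power] A_le]) simp
    then show ?thesis
      using summable_on_reindex_bij_betw[OF e, of "\<lambda>k. measure mu_prod (A k)"]
      by (intro summable_on_imp_summable) simp
  qed
  then have "AE w in mu_prod. eventually (\<lambda>i. w \<in> space mu_prod - A (e i)) sequentially"
    by (intro borel_cantelli_AE1) (auto simp: emeasure_eq_measure)
  then show ?thesis
  proof eventually_elim
    case (elim w)
    then obtain i0 where i0: "\<And>i. i \<ge> i0 \<Longrightarrow> w \<in> space mu_prod - A (e i)"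
      unfolding eventually_sequentially by blast
    define X where "X = e ` {..<i0}"
    have "finite X" by (simp add: X_def)
    \<comment> \<open>The finitely many exceptional \<open>k\<close> have bounded norm, so they do not affect the lower limit.\<close>
    define N where "N = Suc (nat \<lceil>Max (insert 0 (norm1 ` X))\<rceil>)"
    have out: "w \<in> space mu_prod - A k" if "k \<notin> X" for k
    proof -
      obtain i where "k = e i" using e by (metis bij_pointE)
      moreover from this that have "\<not> i < i0" by (auto simp: X_def)
      ultimately show ?thesis using i0[of i] by simp
    qed
    have "cmod (w k) * norm1 k ^ CARD('n) \<ge> 1 / real (Suc 0)" if k: "k \<in> ?G" "norm1 k \<ge> real N" for k
    proof -
      have "k \<notin> X"
      proof
        assume "k \<in> X"
        then have "norm1 k \<le> Max (insert 0 (norm1 ` X))" using \<open>finite X\<close> by (intro Max_ge) auto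
        also have "\<dots> < real N" unfolding N_def by linarith
        finally show False using k(2) by simp
      qed
      then have "r k \<le> cmod (w k)" using out[of k] k(1) by (auto simp: A_def)
      then show ?thesis using norm[OF k(1)] by (simp add: r_def divide_simps)
    qed
    moreover have "w \<in> space mu_prod" using i0[of i0] by blast
    ultimately show ?case unfolding lower_bounded_set_def by blast
  qed
qed

section \<open>The generic set has full measure\<close>

definition generic_set :: "real \<Rightarrow> (int ^ 'n::{finite,linorder} \<Rightarrow> complex) set" where
  "generic_set s = {w \<in> lower_bounded_set. \<forall>k\<in>GG_gen.
     morse (ray_trace 0 s k w) \<and> distinct_critical_values (ray_trace 0 s k w)}"

lemma generic_set_subset: "generic_set s \<subseteq> space mu_prod"
  by (auto simp: generic_set_def lower_bounded_set_def)

lemma generic_set_measurable: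
  assumes "s > 0"
  shows "generic_set s \<in> sets mu_prod"
proof -
  have "{w \<in> space mu_prod. k \<in> GG_gen \<longrightarrow>
      morse (ray_trace 0 s k w) \<and> distinct_critical_values (ray_trace 0 s k w)} \<in> sets mu_prod" for k
    using morse_rays_measurable[OF assms, of k] GG_gen_subset by (cases "k \<in> GG_gen") auto
  then have "lower_bounded_set \<inter> {w \<in> space mu_prod. \<forall>k. k \<in> GG_gen \<longrightarrow>
      morse (ray_trace 0 s k w) \<and> distinct_critical_values (ray_trace 0 s k w)} \<in> sets mu_prod"
    by (intro sets.Int lower_bounded_set_measurable sets.sets_Collect_countable_All)
  also have "lower_bounded_set \<inter> {w \<in> space mu_prod. \<forall>k. k \<in> GG_gen \<longrightarrow>
      morse (ray_trace 0 s k w) \<and> distinct_critical_values (ray_trace 0 s k w)} = generic_set s"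
    by (auto simp: generic_set_def lower_bounded_set_def)
  finally show ?thesis .
qed

lemma emeasure_generic_set:
  assumes "s > 0"
  shows "emeasure mu_prod (generic_set s :: (int ^ 'n::{finite,linorder} \<Rightarrow> complex) set) = 1"
proof -
  interpret prob_space "mu_prod :: (int ^ 'n::{finite,linorder} \<Rightarrow> complex) measure"
    by (rule prob_space_mu_prod)
  have "AE w in mu_prod. \<forall>k\<in>(GG_gen :: (int ^ 'n::{finite,linorder}) set).
      morse (ray_trace 0 s k w) \<and> distinct_critical_values (ray_trace 0 s k w)"
    unfolding AE_ball_countable[OF countableI_type]
    using AE_morse_ray[OF assms] GG_gen_subset by blast
  then have "AE w in mu_prod. w \<in> (generic_set s :: (int ^ 'n::{finite,linorder} \<Rightarrow> complex) set)"
    using AE_lower_bounded by eventually_elim (simp add: generic_set_def)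
  then show ?thesis
    using generic_set_measurable[OF assms] by (intro emeasure_eq_1_AE)
qed

text \<open>
  Both defining properties of \<open>GG s\<close> only involve the Fourier coefficients, hence only the image under
  \<open>fourier_map s\<close>.
\<close>

lemma GG_iff_generic_set:
  assumes s: "s > 0" and f: "f \<in> BB s"
  shows "f \<in> GG s \<longleftrightarrow> fourier_map s f \<in> generic_set s"
proof -
  let ?w = "fourier_map s f"
  have w: "?w \<in> space mu_prod" by (rule fourier_map_in_space[OF f])
  have c: "cmod (fourier_coeff f k) * exp (norm1 k * s) = cmod (?w k)" if "k \<in> GG_gen" for k
    using that GG_gen_subset by (auto simp: fourier_map_def norm_mult)
  have p: "proj_mult k f = ray_trace 0 s k ?w" if "k \<in> GG_gen" for k
    using infsum_mode_coeff_multiples[OF s w] that GG_gen_subset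
    by (auto simp: fun_eq_iff proj_mult_def ray_trace_def fourier_coeff_eq_mode_coeff[OF f])
  show ?thesis
    unfolding GG_def generic_set_def lower_bounded_set_def mem_Collect_eq Liminf_generators_pos_iff
    using f w c p by simp
qed

theorem proposition1p4:
  fixes s :: real
  assumes "s > 0"
  shows "(GG s :: (real ^ 'n::{finite,linorder} \<Rightarrow> real) set) \<in> BB_sets s \<and>
         mu s (GG s :: (real ^ 'n::{finite,linorder} \<Rightarrow> real) set) = 1"
proof
  let ?GG = "GG s :: (real ^ 'n::{finite,linorder} \<Rightarrow> real) set"
  have sub: "?GG \<subseteq> BB s" by (auto simp: GG_def)
  have "?GG = fourier_map s -` generic_set s \<inter> BB s"
    using GG_iff_generic_set[OF assms] sub by blast
  then show "?GG \<in> BB_sets s"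
    using generic_set_measurable[OF assms] unfolding BB_sets_def by blast
  have "fourier_map s ` ?GG = generic_set s"
  proof (intro equalityI subsetI)
    fix w assume "w \<in> fourier_map s ` ?GG"
    then show "w \<in> generic_set s" using GG_iff_generic_set[OF assms] sub by blast
  next
    fix w :: "int ^ 'n::{finite,linorder} \<Rightarrow> complex" assume w: "w \<in> generic_set s"
    then have "w \<in> space mu_prod" using generic_set_subset by blast
    note syn = synthesis_in_BB[OF assms this] fourier_map_synthesis[OF assms this]
    then have "synthesis s w \<in> GG s" using GG_iff_generic_set[OF assms syn(1)] w by simp
    then show "w \<in> fourier_map s ` ?GG" using syn(2) by force
  qed
  then show "mu s ?GG = 1"
    using emeasure_generic_set[OF assms] by (simp add: mu_def)
qed

end
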